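(* For any integer $t\geq 2$, $$r'_2(K_{2,t})\leq CR(K_{2,t},K_3)\leq \left\lfloor\frac{4t}{3}\right\rfloor+2.$$ For any integers $t\geq s\geq 3$, $$r'_2(K_{s,t})\leq CR(K_{s,t},K_3)\leq \left\lceil \frac{2^s}{s+1}(t-1)+\frac{(s-1)(s+6)}{6}\right\rceil+1.$$
   Context: An edge-colored graph $G$ on $p$ vertices with edge-coloring $\chi$ is called orderable if there exist an ordering $(v_1,\ldots,v_p)$ of $V(G)$ and a list $(c_1,\ldots,c_{p-1})$ of not necessarily distinct colors such that for every edge $v_iv_j\in E(G)$ with $i<j$ we have $\chi(v_iv_j)=c_i$. An edge-colored graph is rainbow if all its edges have pairwise different colors. For a graph $G$, $r'_2(G)$ is the minimum integer $n$ such that every 2-edge-coloring of $K_n$ (each edge gets one of two given colors) contains an orderable copy of $G$. For graphs $G,H$, $CR(G,H)$ is the minimum integer $n$ such that every edge-coloring of $K_n$ with any number of colors contains either an orderable copy of $G$ or a rainbow copy of $H$. Copies are (not necessarily induced) subgraphs with the inherited coloring. *)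

theory Defs
  imports Complex_Main "HOL-Library.Extended_Nat"
begin

text \<open>An edge is the two-element set of its endpoints. An edge-coloring is a function on vertex
  sets of which only the values on the edges of the graph at hand are ever used.\<close>

datatype 'a graph = Graph (verts: "'a set") (edges: "'a set set")

definition complete_graph :: "nat \<Rightarrow> nat graph" where
  "complete_graph n = Graph {..<n} {{i, j} | i j. i < n \<and> j < n \<and> i \<noteq> j}"

definition complete_bipartite :: "nat \<Rightarrow> nat \<Rightarrow> (nat + nat) graph" where
  "complete_bipartite s t =
     Graph (Inl ` {..<s} \<union> Inr ` {..<t}) {{Inl i, Inr j} | i j. i < s \<and> j < t}"

definition subgraph :: "'a graph \<Rightarrow> 'a graph \<Rightarrow> bool" where
  "subgraph H K \<longleftrightarrow> verts H \<subseteq> verts K \<and> edges H \<subseteq> edges K"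

definition isomorphic :: "'a graph \<Rightarrow> 'b graph \<Rightarrow> bool" where
  "isomorphic G H \<longleftrightarrow>
     (\<exists>f. bij_betw f (verts G) (verts H) \<and> edges H = (\<lambda>e. f ` e) ` edges G)"

text \<open>Positions in the two lists are counted from 0; there is no color for the last vertex.\<close>

definition orderable :: "'a graph \<Rightarrow> ('a set \<Rightarrow> 'c) \<Rightarrow> bool" where
  "orderable G \<chi> \<longleftrightarrow>
     (\<exists>vs cs. distinct vs \<and> set vs = verts G \<and> length cs = length vs - 1 \<and>
        (\<forall>i j. i < j \<and> j < length vs \<and> {vs ! i, vs ! j} \<in> edges G
           \<longrightarrow> \<chi> {vs ! i, vs ! j} = cs ! i))"

definition rainbow :: "'a graph \<Rightarrow> ('a set \<Rightarrow> 'c) \<Rightarrow> bool" where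
  "rainbow G \<chi> \<longleftrightarrow> inj_on \<chi> (edges G)"

definition has_orderable_copy :: "'a graph \<Rightarrow> ('a set \<Rightarrow> 'c) \<Rightarrow> 'b graph \<Rightarrow> bool" where
  "has_orderable_copy K \<chi> G \<longleftrightarrow> (\<exists>G'. subgraph G' K \<and> isomorphic G G' \<and> orderable G' \<chi>)"

definition has_rainbow_copy :: "'a graph \<Rightarrow> ('a set \<Rightarrow> 'c) \<Rightarrow> 'b graph \<Rightarrow> bool" where
  "has_rainbow_copy K \<chi> H \<longleftrightarrow> (\<exists>H'. subgraph H' K \<and> isomorphic H H' \<and> rainbow H' \<chi>)"

text \<open>Both minima are taken in \<^typ>\<open>enat\<close>, so that they are \<open>\<infinity>\<close> if no suitable \<open>n\<close> exists; a finite
  upper bound thus includes the existence of a suitable \<open>n\<close>. In \<open>CR\<close>, colors taken from \<^typ>\<open>nat\<close>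
  amount to any number of colors, as a complete graph has finitely many edges.\<close>

definition r2' :: "'a graph \<Rightarrow> enat" where
  "r2' G = Inf {enat n | n. \<forall>\<chi> :: nat set \<Rightarrow> bool. has_orderable_copy (complete_graph n) \<chi> G}"

definition CR :: "'a graph \<Rightarrow> 'b graph \<Rightarrow> enat" where
  "CR G H = Inf {enat n | n. \<forall>\<chi> :: nat set \<Rightarrow> nat.
     has_orderable_copy (complete_graph n) \<chi> G \<or> has_rainbow_copy (complete_graph n) \<chi> H}"

end

theory Submission
  imports Defs
begin

text \<open>In a coloring of \<open>V\<close> without rainbow triangle, with \<open>n = |V|\<close>, some orderable
  \<open>K\<^sub>s\<^sub>,\<^sub>t\<close> has \<open>t \<ge> (s + 1) / 2\<^sup>s * (n - s (s + 5) / 6)\<close>, strictly if \<open>s \<ge> 3\<close>. The proof is by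
  induction on \<open>n\<close>. If only two colors occur, pick the \<open>s\<close> vertices of the small side and their order
  uniformly at random and their colors by independent fair coins; the expected number of compatible
  vertices is bounded by a recursion on \<open>s\<close> for falling factorials. Otherwise Gallai's
  structure theorem provides a proper homogeneous set \<open>M\<close> with at least two vertices that sends at most
  two colors to its complement. If \<open>|M| \<ge> s\<close>, apply induction inside \<open>M\<close>: every vertex outside \<open>M\<close>
  may be put in front. If \<open>|M| < s\<close>, start with \<open>M\<close> and continue by induction with
  \<open>s - |M|\<close> in the larger of the two color neighbourhoods of \<open>M\<close>.\<close>

subsection \<open>Colorings without rainbow triangle\<close>

text \<open>No triangle inside \<open>V\<close> is rainbow; such colorings are known as Gallai
  colorings.\<close>

definition gallai :: "('a set \<Rightarrow> 'c) \<Rightarrow> 'a set \<Rightarrow> bool" where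
  "gallai \<chi> V \<longleftrightarrow> (\<forall>x\<in>V. \<forall>y\<in>V. \<forall>z\<in>V. x \<noteq> y \<longrightarrow> y \<noteq> z \<longrightarrow> x \<noteq> z \<longrightarrow>
     \<chi> {x, y} = \<chi> {y, z} \<or> \<chi> {x, y} = \<chi> {x, z} \<or> \<chi> {y, z} = \<chi> {x, z})"

lemma gallaiD:
  assumes "gallai \<chi> V" "x \<in> V" "y \<in> V" "z \<in> V" "x \<noteq> y" "y \<noteq> z" "x \<noteq> z"
  shows "\<chi> {x, y} = \<chi> {y, z} \<or> \<chi> {x, y} = \<chi> {x, z} \<or> \<chi> {y, z} = \<chi> {x, z}"
  using assms unfolding gallai_def by blast

lemma gallai_subset: "gallai \<chi> V \<Longrightarrow> U \<subseteq> V \<Longrightarrow> gallai \<chi> U"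
  unfolding gallai_def by (meson subsetD)

text \<open>These are the modules of modular decomposition, with edge colors in place of
  adjacency.\<close>

definition homogeneous :: "('a set \<Rightarrow> 'c) \<Rightarrow> 'a set \<Rightarrow> 'a set \<Rightarrow> bool" where
  "homogeneous \<chi> V M \<longleftrightarrow> M \<subseteq> V \<and> (\<forall>z\<in>V - M. \<forall>x\<in>M. \<forall>y\<in>M. \<chi> {x, z} = \<chi> {y, z})"

lemma homogeneousD:
  "homogeneous \<chi> V M \<Longrightarrow> x \<in> M \<Longrightarrow> y \<in> M \<Longrightarrow> z \<in> V \<Longrightarrow> z \<notin> M \<Longrightarrow> \<chi> {x, z} = \<chi> {y, z}"
  unfolding homogeneous_def by blast

section \<open>Components of a single color\<close>

definition color_rel :: "('a set \<Rightarrow> 'c) \<Rightarrow> 'a set \<Rightarrow> 'c \<Rightarrow> 'a rel" where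
  "color_rel \<chi> V c = {(x, y). x \<in> V \<and> y \<in> V \<and> x \<noteq> y \<and> \<chi> {x, y} = c}"

definition color_comp :: "('a set \<Rightarrow> 'c) \<Rightarrow> 'a set \<Rightarrow> 'c \<Rightarrow> 'a \<Rightarrow> 'a set" where
  "color_comp \<chi> V c v = {x. (v, x) \<in> (color_rel \<chi> V c)\<^sup>*}"

definition color_connected :: "('a set \<Rightarrow> 'c) \<Rightarrow> 'a set \<Rightarrow> 'c \<Rightarrow> bool" where
  "color_connected \<chi> V c \<longleftrightarrow> (\<forall>v\<in>V. V \<subseteq> color_comp \<chi> V c v)"

lemma sym_color_rel: "sym ((color_rel \<chi> V c)\<^sup>*)"
  by (rule sym_rtrancl) (auto simp: sym_def color_rel_def insert_commute)

lemma color_comp_self [simp]: "v \<in> color_comp \<chi> V c v"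
  by (simp add: color_comp_def)

lemma color_comp_sym: "x \<in> color_comp \<chi> V c y \<Longrightarrow> y \<in> color_comp \<chi> V c x"
  using sym_color_rel[of \<chi> V c] by (auto simp: color_comp_def sym_def)

lemma color_comp_trans:
  "y \<in> color_comp \<chi> V c x \<Longrightarrow> z \<in> color_comp \<chi> V c y \<Longrightarrow> z \<in> color_comp \<chi> V c x"
  by (auto simp: color_comp_def)

lemma color_comp_subset: "v \<in> V \<Longrightarrow> color_comp \<chi> V c v \<subseteq> V"
proof
  fix x assume "v \<in> V" "x \<in> color_comp \<chi> V c v"
  then have "(v, x) \<in> (color_rel \<chi> V c)\<^sup>*" by (simp add: color_comp_def)
  then show "x \<in> V" using \<open>v \<in> V\<close> by cases (auto simp: color_rel_def)
qed

lemma color_comp_closed: "x \<in> color_comp \<chi> V c v \<Longrightarrow> v \<in> V \<Longrightarrow> x \<in> V"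
  using subsetD[OF color_comp_subset] .

lemma color_comp_edge:
  "x \<in> color_comp \<chi> V c v \<Longrightarrow> x \<in> V \<Longrightarrow> y \<in> V \<Longrightarrow> x \<noteq> y \<Longrightarrow> \<chi> {x, y} = c \<Longrightarrow>
    y \<in> color_comp \<chi> V c v"
  unfolding color_comp_def by (auto simp: color_rel_def intro: rtrancl_into_rtrancl)

text \<open>A component equal to \<open>V\<close> would connect any two vertices of \<open>V\<close>
  through \<open>v\<close>.\<close>

lemma color_comp_proper:
  assumes "\<not> color_connected \<chi> V c" "v \<in> V"
  shows "color_comp \<chi> V c v \<subset> V"
proof -
  obtain p q where pq: "p \<in> V" "q \<in> V" "q \<notin> color_comp \<chi> V c p"
    using assms(1) unfolding color_connected_def by blast
  have "p \<notin> color_comp \<chi> V c v \<or> q \<notin> color_comp \<chi> V c v"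
    using color_comp_trans[OF color_comp_sym, of p \<chi> V c v q] pq(3) by blast
  then show ?thesis using color_comp_subset[OF assms(2), of \<chi> c] pq(1,2) by auto
qed

text \<open>Walk along a path of color \<open>c\<close> inside the component. An outside vertex
  \<open>z\<close> sends colors other than \<open>c\<close> to both ends of each edge of the path,
  so the absence of a rainbow triangle makes these two colors equal.\<close>

lemma color_comp_homogeneous:
  assumes g: "gallai \<chi> V" and v: "v \<in> V"
  shows "homogeneous \<chi> V (color_comp \<chi> V c v)"
proof -
  have eq: "\<chi> {x, z} = \<chi> {v, z}" if z: "z \<in> V" "z \<notin> color_comp \<chi> V c v"
    and x: "x \<in> color_comp \<chi> V c v" for x z
  proof -
    have "(v, x) \<in> (color_rel \<chi> V c)\<^sup>*" using x by (simp add: color_comp_def)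
    then show ?thesis
    proof (induction rule: rtrancl_induct)
      case base show ?case ..
    next
      case (step y x)
      have yx: "y \<in> V" "x \<in> V" "x \<noteq> y" "\<chi> {x, y} = c"
        using step by (auto simp: color_rel_def insert_commute)
      have cy: "y \<in> color_comp \<chi> V c v" and cx: "x \<in> color_comp \<chi> V c v"
        using step by (auto simp: color_comp_def)
      have "\<chi> {y, z} \<noteq> c" "\<chi> {x, z} \<noteq> c" "y \<noteq> z" "x \<noteq> z"
        using cx cy z yx color_comp_edge by metis+
      then show ?case using gallaiD[OF g yx(2,1) z(1)] yx step by metis
    qed
  qed
  show ?thesis unfolding homogeneous_def
  proof (intro conjI ballI)
    show "color_comp \<chi> V c v \<subseteq> V" by (rule color_comp_subset[OF v])
    fix z x y
    assume "z \<in> V - color_comp \<chi> V c v" "x \<in> color_comp \<chi> V c v" "y \<in> color_comp \<chi> V c v"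
    then show "\<chi> {x, z} = \<chi> {y, z}" using eq[of z x] eq[of z y] by simp
  qed
qed

lemma color_connected_neighbour:
  assumes "color_connected \<chi> V c" "w \<in> V" "v \<in> V" "v \<noteq> w"
  obtains x where "x \<in> V" "x \<noteq> w" "\<chi> {w, x} = c"
proof -
  have "(w, v) \<in> (color_rel \<chi> V c)\<^sup>*"
    using assms unfolding color_connected_def color_comp_def by blast
  then show ?thesis using assms(4) that
    by (cases rule: converse_rtranclE) (auto simp: color_rel_def)
qed

text \<open>A path of color \<open>c\<close> from \<open>v\<close> to \<open>w\<close> stays in the
  component of \<open>v\<close> in \<open>V - {w}\<close> until it first reaches \<open>w\<close>;
  the vertex before that is the required \<open>y\<close>.\<close>

lemma component_meets_neighbourhood:
  assumes c: "color_connected \<chi> V c" and w: "w \<in> V" and v: "v \<in> V - {w}"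
  obtains y where "y \<in> color_comp \<chi> (V - {w}) c v" "\<chi> {w, y} = c"
proof (rule ccontr)
  assume "\<not> thesis"
  with that have no: "\<And>y. y \<in> color_comp \<chi> (V - {w}) c v \<Longrightarrow> \<chi> {w, y} \<noteq> c" by blast
  have "(v, w) \<in> (color_rel \<chi> V c)\<^sup>*"
    using c w v unfolding color_connected_def color_comp_def by blast
  moreover have "u \<in> color_comp \<chi> (V - {w}) c v" if "(v, u) \<in> (color_rel \<chi> V c)\<^sup>*" for u
    using that
  proof (induction rule: rtrancl_induct)
    case base show ?case by simp
  next
    case (step y z)
    have "y \<in> V - {w}" using step.IH v by (rule color_comp_closed)
    moreover have "z \<noteq> w" using no[OF step.IH] step by (auto simp: color_rel_def insert_commute)
    ultimately show ?case using step.hyps color_comp_edge[OF step.IH, of z]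
      by (simp add: color_rel_def)
  qed
  ultimately show False using color_comp_closed[OF _ v, of w \<chi> c] by simp
qed

text \<open>If \<open>c\<close> falls apart on \<open>V - {w}\<close>, a vertex joined to
  \<open>w\<close> in a color \<open>d\<close> other than \<open>c\<close> sends \<open>d\<close> to
  everything outside its own \<open>c\<close>-component (fact \<open>cross\<close>). Neighbours
  \<open>x\<close> and \<open>y\<close> of \<open>w\<close> in colors \<open>a\<close> and
  \<open>b\<close> then contradict each other: in one component, an outside vertex would see both
  colors although the component is homogeneous; in different components, the edge
  \<open>{x, y}\<close> would have both colors.\<close>

lemma connected_after_removal:
  assumes g: "gallai \<chi> V" and w: "w \<in> V" and V: "V - {w} \<noteq> {}"
    and conn: "color_connected \<chi> V a" "color_connected \<chi> V b" "color_connected \<chi> V c"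
    and ne: "a \<noteq> b" "a \<noteq> c" "b \<noteq> c"
  shows "color_connected \<chi> (V - {w}) c"
proof (rule ccontr)
  assume nc: "\<not> color_connected \<chi> (V - {w}) c"
  let ?U = "V - {w}"
  have gU: "gallai \<chi> ?U" using g gallai_subset by blast
  have cross: "\<chi> {x, z} = d"
    if x: "x \<in> ?U" and z: "z \<in> ?U" "z \<notin> color_comp \<chi> ?U c x" and d: "\<chi> {w, x} = d" "d \<noteq> c"
    for x z d
  proof -
    \<comment> \<open>The component of \<open>z\<close> contains a vertex \<open>y\<close> joined to
      \<open>w\<close> in color \<open>c\<close>. In the triangle on \<open>w\<close>,
      \<open>x\<close>, \<open>y\<close> the edge \<open>{x, y}\<close> must then have color
      \<open>d\<close>, and homogeneity of this component carries \<open>d\<close> over from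
      \<open>y\<close> to \<open>z\<close>.\<close>
    obtain y where y: "y \<in> color_comp \<chi> ?U c z" "\<chi> {w, y} = c"
      using component_meets_neighbourhood[OF conn(3) w z(1)] by blast
    have yU: "y \<in> ?U" using y(1) z(1) by (rule color_comp_closed)
    have yx: "y \<notin> color_comp \<chi> ?U c x"
      using color_comp_trans[OF _ color_comp_sym[OF y(1)]] z(2) by blast
    have "x \<noteq> y" using yx by auto
    moreover have "\<chi> {x, y} \<noteq> c"
      using yx \<open>x \<noteq> y\<close> x yU color_comp_edge[of x \<chi> ?U c x y] by auto
    ultimately have "\<chi> {x, y} = d"
      using gallaiD[OF g w, of x y] x yU y d by (metis DiffE singletonI)
    moreover have "x \<notin> color_comp \<chi> ?U c z" using z color_comp_sym by metis
    then have "\<chi> {y, x} = \<chi> {z, x}"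
      using homogeneousD[OF color_comp_homogeneous[OF gU z(1)] y(1) _ x] by simp
    ultimately show ?thesis by (simp add: insert_commute)
  qed
  obtain u where u: "u \<in> ?U" using V by blast
  obtain x where x: "x \<in> ?U" "\<chi> {w, x} = a"
    using color_connected_neighbour[OF conn(1) w] u by blast
  obtain y where y: "y \<in> ?U" "\<chi> {w, y} = b"
    using color_connected_neighbour[OF conn(2) w] u by blast
  show False
  proof (cases "y \<in> color_comp \<chi> ?U c x")
    case True
    obtain z where z: "z \<in> ?U" "z \<notin> color_comp \<chi> ?U c x"
      using color_comp_proper[OF nc x(1)] by blast
    have "z \<notin> color_comp \<chi> ?U c y" using color_comp_trans[OF True, of z] z(2) by blast
    then have "\<chi> {y, z} = b" using cross y z ne by blast
    moreover have "\<chi> {x, z} = a" using cross x z ne by blast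
    moreover have "\<chi> {x, z} = \<chi> {y, z}"
      using homogeneousD[OF color_comp_homogeneous[OF gU x(1)] _ True z] by simp
    ultimately show False using ne by simp
  next
    case False
    then have "x \<notin> color_comp \<chi> ?U c y" using color_comp_sym by metis
    then have "\<chi> {y, x} = b" using cross x y ne by blast
    moreover have "\<chi> {x, y} = a" using False cross x y ne by blast
    ultimately show False using ne by (simp add: insert_commute)
  qed
qed

text \<open>Removing vertices one at a time keeps all three colors connected, until two vertices are
  left whose only edge would need all three colors.\<close>

lemma not_three_connected_colors:
  assumes "finite V" "card V \<ge> 2" "gallai \<chi> V"
    and "color_connected \<chi> V a" "color_connected \<chi> V b" "color_connected \<chi> V c"
    and ne: "a \<noteq> b" "a \<noteq> c" "b \<noteq> c"
  shows False
  using assms(1-6)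
proof (induction V rule: finite_psubset_induct)
  case (psubset V)
  obtain w where w: "w \<in> V" using psubset.prems by fastforce
  have cU: "card (V - {w}) = card V - 1" using w by simp
  then have ne': "V - {w} \<noteq> {}"
    using psubset.prems by (metis One_nat_def card.empty diff_is_0_eq not_less_eq_eq numeral_2_eq_2)
  show False
  proof (cases "card V = 2")
    case True
    then have "card (V - {w}) = 1" using cU by simp
    then obtain u where u: "V - {w} = {u}" by (rule card_1_singletonE)
    have "\<chi> {w, u} = d" if d: "color_connected \<chi> V d" for d
    proof -
      have "u \<in> V" "u \<noteq> w" using u by auto
      from color_connected_neighbour[OF d w this]
      obtain x where "x \<in> V" "x \<noteq> w" "\<chi> {w, x} = d" .
      moreover from this have "x = u" using u by blast
      ultimately show ?thesis by simp
    qed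
    then show False using psubset.prems(3,4) ne(1) by metis
  next
    case False
    note r = connected_after_removal[OF psubset.prems(2) w ne']
    have "color_connected \<chi> (V - {w}) a"
      by (rule r[of b c]) (use psubset.prems ne in auto)
    moreover have "color_connected \<chi> (V - {w}) b"
      by (rule r[of a c]) (use psubset.prems ne in auto)
    moreover have "color_connected \<chi> (V - {w}) c"
      by (rule r[of a b]) (use psubset.prems ne in auto)
    moreover have "V - {w} \<subset> V" using w by blast
    moreover have "gallai \<chi> (V - {w})" using psubset.prems gallai_subset by blast
    moreover have "2 \<le> card (V - {w})" using cU False psubset.prems by linarith
    ultimately show False by (intro psubset.IH[of "V - {w}"])
  qed
qed

lemma subset_doubleton_if_no_three_distinct:
  assumes "\<And>x y z. x \<in> S \<Longrightarrow> y \<in> S \<Longrightarrow> z \<in> S \<Longrightarrow> x = y \<or> x = z \<or> y = z"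
  shows "\<exists>a b. S \<subseteq> {a, b}"
proof (cases "\<exists>a\<in>S. \<exists>b\<in>S. a \<noteq> b")
  case True
  then obtain a b where "a \<in> S" "b \<in> S" "a \<noteq> b" by blast
  then have "S \<subseteq> {a, b}" using assms[of _ a b] by auto
  then show ?thesis by blast
next
  case False
  then have "S \<subseteq> {SOME a. a \<in> S}" by (metis insertI1 someI subsetI)
  then show ?thesis by blast
qed

text \<open>Take a largest proper nonempty homogeneous set \<open>M\<close>. Components of
  disconnected colors are homogeneous and proper, hence no larger than \<open>M\<close>. This forces
  every color leaving \<open>M\<close> to be connected, so there are at most two of them; if
  \<open>M\<close> is a singleton, it forces every color to be connected, so there are at most two
  colors in all.\<close>

lemma gallai_structure:
  assumes fin: "finite V" and card: "card V \<ge> 2" and g: "gallai \<chi> V"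
  obtains
    (two_colored) a b where "\<And>x y. x \<in> V \<Longrightarrow> y \<in> V \<Longrightarrow> x \<noteq> y \<Longrightarrow> \<chi> {x, y} \<in> {a, b}"
  | (homogeneous) M a b where "homogeneous \<chi> V M" "2 \<le> card M" "card M < card V"
      "\<And>x z. x \<in> M \<Longrightarrow> z \<in> V - M \<Longrightarrow> \<chi> {x, z} \<in> {a, b}"
proof -
  define P where "P M \<longleftrightarrow> homogeneous \<chi> V M \<and> M \<noteq> {} \<and> M \<subset> V" for M
  have Pc: "card M < card V" if "P M" for M
    using that fin unfolding P_def by (auto intro: psubset_card_mono)
  obtain v where v: "v \<in> V" using card by fastforce
  have "P {v}" unfolding P_def homogeneous_def using v card by auto
  then obtain M where M: "P M" and max: "\<And>N. P N \<Longrightarrow> card N \<le> card M"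
    using ex_has_greatest_nat[of P "{v}" card "card V"] Pc by (metis less_imp_le)
  have comp: "card (color_comp \<chi> V c x) \<le> card M" if "x \<in> V" "\<not> color_connected \<chi> V c" for x c
  proof -
    have "x \<in> color_comp \<chi> V c x" by simp
    then have "P (color_comp \<chi> V c x)" unfolding P_def
      using color_comp_homogeneous[OF g that(1)] color_comp_proper[OF that(2,1)] by blast
    then show ?thesis by (rule max)
  qed
  have MV: "M \<subseteq> V" "M \<noteq> {}" "finite M" using M fin finite_subset unfolding P_def by auto
  have connM: "color_connected \<chi> V (\<chi> {x, z})" if x: "x \<in> M" and z: "z \<in> V - M" for x z
  proof (rule ccontr)
    let ?c = "\<chi> {x, z}"
    assume "\<not> color_connected \<chi> V ?c"
    then have le: "card (color_comp \<chi> V ?c x) \<le> card M" using comp x MV by blast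
    \<comment> \<open>The component of \<open>x\<close> takes in \<open>z\<close> and, through
      \<open>z\<close>, all of \<open>M\<close>, so it is larger than \<open>M\<close>.\<close>
    have zc: "z \<in> color_comp \<chi> V ?c x" using x z MV color_comp_edge[of x \<chi> V ?c x z] by auto
    have "y \<in> color_comp \<chi> V ?c x" if "y \<in> M" for y
    proof -
      have "\<chi> {y, z} = ?c" using M x z that unfolding P_def homogeneous_def by blast
      then have "\<chi> {z, y} = ?c" by (simp add: insert_commute)
      then show ?thesis using color_comp_edge[OF zc, of y] z that MV by blast
    qed
    then have "insert z M \<subseteq> color_comp \<chi> V ?c x" using zc by blast
    moreover have "finite (color_comp \<chi> V ?c x)"
      by (rule finite_subset[OF color_comp_subset fin]) (use x MV in blast)
    ultimately have "card (insert z M) \<le> card M" using le by (meson card_mono le_trans)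
    then show False using z MV by simp
  qed
  define S where "S = {\<chi> {x, z} | x z. x \<in> M \<and> z \<in> V - M}"
  have "\<exists>a b. S \<subseteq> {a, b}"
  proof (rule subset_doubleton_if_no_three_distinct)
    have "color_connected \<chi> V c" if "c \<in> S" for c using that connM unfolding S_def by blast
    then show "a = b \<or> a = c \<or> b = c" if "a \<in> S" "b \<in> S" "c \<in> S" for a b c
      using that not_three_connected_colors[OF fin card g] by metis
  qed
  then obtain a b where ab: "S \<subseteq> {a, b}" by blast
  show ?thesis
  proof (cases "card M \<ge> 2")
    case True
    show ?thesis
      by (rule homogeneous[of M a b])
        (use M Pc True ab in \<open>auto simp: P_def S_def\<close>)
  next
    case False
    \<comment> \<open>A component of a disconnected color would contain both ends of an edge,
      against the maximality of \<open>card M\<close>.\<close>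
    have connV: "color_connected \<chi> V (\<chi> {x, y})" if xy: "x \<in> V" "y \<in> V" "x \<noteq> y" for x y
    proof (rule ccontr)
      let ?C = "color_comp \<chi> V (\<chi> {x, y}) x"
      assume "\<not> color_connected \<chi> V (\<chi> {x, y})"
      then have "card ?C \<le> 1" using comp[OF xy(1)] False by fastforce
      moreover have "{x, y} \<subseteq> ?C" using xy color_comp_edge[of x \<chi> V "\<chi> {x, y}" x y] by simp
      moreover have "finite ?C" by (rule finite_subset[OF color_comp_subset[OF xy(1)] fin])
      ultimately have "card {x, y} \<le> 1" by (meson card_mono le_trans)
      then show False using xy by simp
    qed
    define T where "T = {\<chi> {x, y} | x y. x \<in> V \<and> y \<in> V \<and> x \<noteq> y}"
    have "\<exists>a b. T \<subseteq> {a, b}"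
    proof (rule subset_doubleton_if_no_three_distinct)
      have "color_connected \<chi> V c" if "c \<in> T" for c using that connV unfolding T_def by blast
      then show "a = b \<or> a = c \<or> b = c" if "a \<in> T" "b \<in> T" "c \<in> T" for a b c
        using that not_three_connected_colors[OF fin card g] by metis
    qed
    then obtain a' b' where "T \<subseteq> {a', b'}" by blast
    then show ?thesis by (intro two_colored[of a' b']) (auto simp: T_def)
  qed
qed

subsection \<open>Orderable complete bipartite graphs\<close>

text \<open>Such a \<open>b\<close> may precede all of \<open>X\<close> in an ordering.\<close>

definition sees_constant :: "('a set \<Rightarrow> 'c) \<Rightarrow> 'a \<Rightarrow> 'a set \<Rightarrow> bool" where
  "sees_constant \<chi> b X \<longleftrightarrow> (\<forall>x\<in>X. \<forall>y\<in>X. \<chi> {x, b} = \<chi> {y, b})"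

text \<open>A linear arrangement of the listed vertices and \<open>B\<close>: the vertices of \<open>K\<close> are placed in front
  of \<open>x\<close>, those of the smaller set behind it.\<close>

inductive ordered_pair :: "('a set \<Rightarrow> 'c) \<Rightarrow> 'a list \<Rightarrow> 'a set \<Rightarrow> bool" for \<chi> where
  Nil: "ordered_pair \<chi> [] B"
| Cons: "ordered_pair \<chi> xs B \<Longrightarrow> (\<And>b. b \<in> B \<Longrightarrow> \<chi> {x, b} = c) \<Longrightarrow>
    (\<And>b. b \<in> K \<Longrightarrow> sees_constant \<chi> b (insert x (set xs))) \<Longrightarrow> ordered_pair \<chi> (x # xs) (B \<union> K)"

text \<open>The vertices of \<open>K\<close> join those in front of the first listed vertex.\<close>

lemma ordered_pair_add_constant:
  assumes "ordered_pair \<chi> xs B" "\<And>b. b \<in> K \<Longrightarrow> sees_constant \<chi> b (set xs)"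
  shows "ordered_pair \<chi> xs (B \<union> K)"
  using assms
proof cases
  case (Cons ys C x c L)
  have "ordered_pair \<chi> (x # ys) (C \<union> (L \<union> K))"
    by (rule ordered_pair.Cons) (use Cons assms(2) in auto)
  then show ?thesis using Cons by (simp add: Un_assoc)
qed (auto intro: ordered_pair.Nil)

lemma ordered_pair_subset:
  assumes "ordered_pair \<chi> xs B" "C \<subseteq> B"
  shows "ordered_pair \<chi> xs C"
  using assms
proof (induction arbitrary: C rule: ordered_pair.induct)
  case (Cons xs B x c K)
  have "ordered_pair \<chi> (x # xs) ((C \<inter> B) \<union> (C \<inter> K))"
    by (rule ordered_pair.Cons) (use Cons in auto)
  moreover have "(C \<inter> B) \<union> (C \<inter> K) = C" using Cons.prems by blast
  ultimately show ?case by simp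
qed (auto intro: ordered_pair.Nil)

lemma ordered_pair_append:
  assumes "ordered_pair \<chi> ys B" "\<And>x b. x \<in> set xs \<Longrightarrow> b \<in> B \<Longrightarrow> \<chi> {x, b} = c"
  shows "ordered_pair \<chi> (xs @ ys) B"
  using assms(2)
proof (induction xs)
  case (Cons x xs)
  have "ordered_pair \<chi> (x # (xs @ ys)) (B \<union> {})"
    by (rule ordered_pair.Cons[where c = c]) (use Cons in auto)
  then show ?case by simp
qed (use assms(1) in simp)

text \<open>Placed last, \<open>b\<close> receives a single edge from each listed vertex, so any
  colors fit.\<close>

lemma ordered_pair_single_right: "ordered_pair \<chi> xs {b}"
proof (induction xs)
  case (Cons x xs)
  have "ordered_pair \<chi> (x # xs) ({b} \<union> {})"
    by (rule ordered_pair.Cons[OF Cons, where c = "\<chi> {x, b}"]) auto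
  then show ?case by simp
qed (rule ordered_pair.Nil)

text \<open>All of \<open>B\<close> goes in front of \<open>a\<close>, and each of its vertices has
  only one edge to color.\<close>

lemma ordered_pair_single_left: "ordered_pair \<chi> [a] B"
proof -
  have "ordered_pair \<chi> [a] ({} \<union> B)"
    by (rule ordered_pair.Cons[OF ordered_pair.Nil]) (auto simp: sees_constant_def)
  then show ?thesis by simp
qed

section \<open>From arrangements to orderings of a vertex list\<close>

fun ordered_list :: "'a set set \<Rightarrow> ('a set \<Rightarrow> 'c) \<Rightarrow> 'a list \<Rightarrow> bool" where
  "ordered_list E \<chi> [] \<longleftrightarrow> True"
| "ordered_list E \<chi> (v # vs) \<longleftrightarrow>
     (\<exists>c. \<forall>w\<in>set vs. {v, w} \<in> E \<longrightarrow> \<chi> {v, w} = c) \<and> ordered_list E \<chi> vs"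

lemma ordered_list_append:
  assumes "ordered_list E \<chi> vs"
    and "\<And>b. b \<in> set bs \<Longrightarrow> \<exists>c. \<forall>w \<in> set bs \<union> set vs. {b, w} \<in> E \<longrightarrow> \<chi> {b, w} = c"
  shows "ordered_list E \<chi> (bs @ vs)"
  using assms(2)
proof (induction bs)
  case (Cons b bs)
  have "ordered_list E \<chi> (bs @ vs)"
  proof (rule Cons.IH)
    fix a assume "a \<in> set bs"
    then show "\<exists>c. \<forall>w \<in> set bs \<union> set vs. {a, w} \<in> E \<longrightarrow> \<chi> {a, w} = c"
      using Cons.prems[of a] by auto
  qed
  moreover obtain c where "\<forall>w \<in> set (b # bs) \<union> set vs. {b, w} \<in> E \<longrightarrow> \<chi> {b, w} = c"
    using Cons.prems[of b] by auto
  ultimately show ?case by auto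
qed (use assms(1) in simp)

text \<open>The last vertex receives a color too, which keeps the induction uniform;
  \<open>orderable_if_ordered_list\<close> drops it.\<close>

lemma ordered_list_colors:
  assumes "ordered_list E \<chi> vs"
  shows "\<exists>cs. length cs = length vs \<and>
    (\<forall>i j. i < j \<and> j < length vs \<and> {vs ! i, vs ! j} \<in> E \<longrightarrow> \<chi> {vs ! i, vs ! j} = cs ! i)"
  using assms
proof (induction vs)
  case (Cons v vs)
  then obtain cs where cs: "length cs = length vs"
    "\<And>i j. i < j \<Longrightarrow> j < length vs \<Longrightarrow> {vs ! i, vs ! j} \<in> E \<Longrightarrow> \<chi> {vs ! i, vs ! j} = cs ! i"
    by auto
  obtain c where c: "\<And>w. w \<in> set vs \<Longrightarrow> {v, w} \<in> E \<Longrightarrow> \<chi> {v, w} = c" using Cons by auto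
  show ?case
  proof (intro exI[of _ "c # cs"] conjI allI impI)
    fix i j assume ij: "i < j \<and> j < length (v # vs) \<and> {(v # vs) ! i, (v # vs) ! j} \<in> E"
    then obtain j' where j: "j = Suc j'" by (cases j) auto
    show "\<chi> {(v # vs) ! i, (v # vs) ! j} = (c # cs) ! i"
      by (cases i) (use ij j c cs(2) in auto)
  qed (use cs in simp)
qed simp

lemma orderable_if_ordered_list:
  assumes "ordered_list (edges G) \<chi> vs" "distinct vs" "set vs = verts G"
  shows "orderable G \<chi>"
proof -
  obtain cs where cs: "length cs = length vs"
    "\<And>i j. i < j \<Longrightarrow> j < length vs \<Longrightarrow> {vs ! i, vs ! j} \<in> edges G \<Longrightarrow> \<chi> {vs ! i, vs ! j} = cs ! i"
    using ordered_list_colors[OF assms(1)] by blast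
  have "i < length vs - 1" if "i < j" "j < length vs" for i j using that by linarith
  then show ?thesis unfolding orderable_def
    by (intro exI[of _ vs] exI[of _ "take (length vs - 1) cs"]) (use assms cs in auto)
qed

text \<open>The vertex list is built along the derivation: each step prepends \<open>x\<close> and
  then the vertices of \<open>K\<close>. The sides \<open>X\<close> and \<open>Y\<close> are fixed
  supersets, so that the edge set stays the same throughout the induction.\<close>

lemma ordered_list_of_ordered_pair:
  assumes "ordered_pair \<chi> xs B" "distinct xs" "set xs \<subseteq> X" "B \<subseteq> Y" "X \<inter> Y = {}" "finite Y"
  shows "\<exists>vs. distinct vs \<and> set vs = set xs \<union> B \<and>
    ordered_list {{x, b} | x b. x \<in> X \<and> b \<in> Y} \<chi> vs"
  using assms
proof (induction rule: ordered_pair.induct)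
  case (Nil B)
  let ?E = "{{x, b} | x b. x \<in> X \<and> b \<in> Y}"
  obtain bs where bs: "set bs = B" "distinct bs"
    using Nil finite_distinct_list finite_subset by metis
  have "ordered_list ?E \<chi> (bs @ [])"
  proof (rule ordered_list_append)
    fix b assume "b \<in> set bs"
    then have "{b, w} \<notin> ?E" if "w \<in> set bs \<union> set []" for w
      using that Nil.prems bs by (auto simp: doubleton_eq_iff)
    then show "\<exists>c. \<forall>w \<in> set bs \<union> set []. {b, w} \<in> ?E \<longrightarrow> \<chi> {b, w} = c" by blast
  qed simp
  then show ?case using bs by auto
next
  case (Cons xs B x c K)
  let ?E = "{{x, b} | x b. x \<in> X \<and> b \<in> Y}"
  obtain vs where vs: "distinct vs" "set vs = set xs \<union> B" "ordered_list ?E \<chi> vs"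
    using Cons by auto
  \<comment> \<open>\<open>K\<close> may meet \<open>B\<close>, whose vertices already have a place
    in \<open>vs\<close>.\<close>
  have "finite (K - B)" using Cons.prems finite_subset by blast
  then obtain bs where bs: "set bs = K - B" "distinct bs" using finite_distinct_list by metis
  have x: "x \<in> X" "x \<notin> Y" using Cons.prems by auto
  have "\<chi> {x, w} = c" if "w \<in> set vs" "{x, w} \<in> ?E" for w
  proof -
    have "w \<in> Y" using that x by (auto simp: doubleton_eq_iff)
    then have "w \<in> B" using that vs Cons.prems by auto
    then show ?thesis by (rule Cons)
  qed
  then have "ordered_list ?E \<chi> (x # vs)" using vs by auto
  then have "ordered_list ?E \<chi> (bs @ x # vs)"
  proof (rule ordered_list_append)
    fix b assume b: "b \<in> set bs"
    then have bY: "b \<in> Y" "b \<notin> X" using bs Cons.prems by auto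
    have "\<chi> {b, w} = \<chi> {x, b}" if "w \<in> set bs \<union> set (x # vs)" "{b, w} \<in> ?E" for w
    proof -
      have "w \<in> X" using that bY by (auto simp: doubleton_eq_iff)
      then have "w \<in> insert x (set xs)" using that bs vs Cons.prems by auto
      then show ?thesis
        using Cons.hyps(3)[of b] b bs unfolding sees_constant_def by (auto simp: insert_commute)
    qed
    then show "\<exists>c. \<forall>w \<in> set bs \<union> set (x # vs). {b, w} \<in> ?E \<longrightarrow> \<chi> {b, w} = c" by blast
  qed
  moreover have "distinct (bs @ x # vs)" using bs vs Cons.prems by auto
  moreover have "set (bs @ x # vs) = set (x # xs) \<union> (B \<union> K)" using bs vs by auto
  ultimately show ?case by blast
qed

text \<open>Cutting \<open>B\<close> down to exactly \<open>t\<close> vertices keeps the pair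
  ordered; positions in the two lists give the isomorphism.\<close>

lemma has_orderable_copy_complete_bipartite:
  assumes op: "ordered_pair \<chi> xs B" and dist: "distinct xs" and len: "length xs = s"
    and card: "t \<le> card B" and sub: "set xs \<subseteq> {..<n}" "B \<subseteq> {..<n}" and disj: "set xs \<inter> B = {}"
  shows "has_orderable_copy (complete_graph n) \<chi> (complete_bipartite s t)"
proof -
  obtain C where C: "C \<subseteq> B" "card C = t" using card by (meson obtain_subset_with_card_n)
  have fin: "finite C" using C sub finite_subset by (metis finite_lessThan)
  obtain cs where cs: "set cs = C" "distinct cs" using fin finite_distinct_list by metis
  have lcs: "length cs = t" using C cs distinct_card by metis
  define G where "G = Graph (set xs \<union> C) {{x, b} | x b. x \<in> set xs \<and> b \<in> C}"
  have "subgraph G (complete_graph n)"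
    unfolding subgraph_def complete_graph_def G_def
    using sub C disj by auto (metis disjoint_iff lessThan_iff subsetD)+
  moreover have "isomorphic (complete_bipartite s t) G"
  proof -
    define f where "f = case_sum (\<lambda>i. xs ! i) (\<lambda>j. cs ! j)"
    have "bij_betw f (verts (complete_bipartite s t)) (verts G)"
      unfolding bij_betw_def
    proof
      have "xs ! i \<noteq> cs ! j" if "i < s" "j < t" for i j
        using that len lcs cs C disj by (metis disjoint_iff nth_mem subsetD)
      then show "inj_on f (verts (complete_bipartite s t))"
        using dist cs len lcs unfolding complete_bipartite_def f_def inj_on_def
        by (auto simp: nth_eq_iff_index_eq) metis
      show "f ` verts (complete_bipartite s t) = verts G"
        unfolding complete_bipartite_def f_def G_def using len lcs cs
        by (auto simp: image_Un image_image set_conv_nth)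
    qed
    moreover have "edges G = (\<lambda>e. f ` e) ` edges (complete_bipartite s t)"
    proof -
      have "(\<lambda>e. f ` e) ` edges (complete_bipartite s t) =
          {f ` {Inl i, Inr j} | i j. i < s \<and> j < t}"
        unfolding complete_bipartite_def by (simp add: setcompr_eq_image) blast
      also have "\<dots> = {{xs ! i, cs ! j} | i j. i < s \<and> j < t}" by (simp add: f_def)
      also have "\<dots> = {{x, b} | x b. x \<in> set xs \<and> b \<in> set cs}"
        using len lcs unfolding in_set_conv_nth by blast
      finally show ?thesis unfolding G_def cs(1) by simp
    qed
    ultimately show ?thesis unfolding isomorphic_def by blast
  qed
  moreover have "orderable G \<chi>"
  proof -
    obtain vs where "distinct vs" "set vs = set xs \<union> C"
      "ordered_list {{x, b} | x b. x \<in> set xs \<and> b \<in> C} \<chi> vs"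
      using ordered_list_of_ordered_pair[OF ordered_pair_subset[OF op C(1)] dist subset_refl subset_refl]
        disj C fin by blast
    then show ?thesis by (intro orderable_if_ordered_list[of _ _ vs]) (auto simp: G_def)
  qed
  ultimately show ?thesis unfolding has_orderable_copy_def by blast
qed

text \<open>A two-coloring, read as a coloring with 0 and 1, has no rainbow triangle by pigeonhole.
  Hence every \<open>n\<close> admissible for \<open>CR\<close> is admissible for
  \<open>r2'\<close>.\<close>

lemma r2'_le_CR_triangle: "r2' G \<le> CR G (complete_graph 3)"
  unfolding r2'_def CR_def
proof (rule Inf_superset_mono, safe)
  fix n
  assume n: "\<forall>\<chi> :: nat set \<Rightarrow> nat. has_orderable_copy (complete_graph n) \<chi> G \<or>
    has_rainbow_copy (complete_graph n) \<chi> (complete_graph 3)"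
  have "has_orderable_copy (complete_graph n) \<chi> G" for \<chi> :: "nat set \<Rightarrow> bool"
  proof -
    define \<psi> :: "nat set \<Rightarrow> nat" where "\<psi> e = of_bool (\<chi> e)" for e
    have "\<not> has_rainbow_copy (complete_graph n) \<psi> (complete_graph 3)"
    proof
      assume "has_rainbow_copy (complete_graph n) \<psi> (complete_graph 3)"
      then obtain H f where f: "bij_betw f {..<3::nat} (verts H)"
        "edges H = (\<lambda>e. f ` e) ` edges (complete_graph 3)" and r: "inj_on \<psi> (edges H)"
        unfolding has_rainbow_copy_def isomorphic_def rainbow_def
        by (auto simp: complete_graph_def)
      have ne: "f 0 \<noteq> f 1" "f 0 \<noteq> f 2" "f 1 \<noteq> f 2"
        using f(1) unfolding bij_betw_def by (auto dest: inj_onD)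
      have e: "{f i, f j} \<in> edges H" if "i < 3" "j < 3" "i \<noteq> j" for i j
      proof -
        have "{i, j} \<in> edges (complete_graph 3)" using that by (auto simp: complete_graph_def)
        then have "f ` {i, j} \<in> edges H" unfolding f(2) by (rule imageI)
        then show ?thesis by simp
      qed
      have "{f 0, f 1} \<in> edges H" "{f 0, f 2} \<in> edges H" "{f 1, f 2} \<in> edges H"
        by (rule e; simp)+
      moreover have "{f 0, f 1} \<noteq> {f 0, f 2}" "{f 0, f 1} \<noteq> {f 1, f 2}" "{f 0, f 2} \<noteq> {f 1, f 2}"
        using ne by (auto simp: doubleton_eq_iff)
      ultimately have "\<psi> {f 0, f 1} \<noteq> \<psi> {f 0, f 2}" "\<psi> {f 0, f 1} \<noteq> \<psi> {f 1, f 2}"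
        "\<psi> {f 0, f 2} \<noteq> \<psi> {f 1, f 2}" using r by (auto dest: inj_onD)
      then show False by (auto simp: \<psi>_def of_bool_def split: if_splits)
    qed
    then obtain G' where G': "subgraph G' (complete_graph n)" "isomorphic G G'" "orderable G' \<psi>"
      using n unfolding has_orderable_copy_def by blast
    then obtain vs cs where vs: "distinct vs" "set vs = verts G'" "length cs = length vs - 1"
      "\<And>i j. i < j \<Longrightarrow> j < length vs \<Longrightarrow> {vs ! i, vs ! j} \<in> edges G' \<Longrightarrow> \<psi> {vs ! i, vs ! j} = cs ! i"
      unfolding orderable_def by blast
    have "orderable G' \<chi>" unfolding orderable_def
    proof (intro exI[of _ vs] exI[of _ "map (\<lambda>c. c = 1) cs"] conjI allI impI)
      fix i j assume ij: "i < j \<and> j < length vs \<and> {vs ! i, vs ! j} \<in> edges G'"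
      then have "i < length cs" using vs(3) by linarith
      then show "\<chi> {vs ! i, vs ! j} = map (\<lambda>c. c = 1) cs ! i"
        using vs(4)[of i j] ij by (auto simp: \<psi>_def of_bool_def split: if_splits)
    qed (use vs in auto)
    then show ?thesis using G' unfolding has_orderable_copy_def by blast
  qed
  then show "\<exists>na. enat n = enat na \<and> (\<forall>\<chi>::nat set \<Rightarrow> bool. has_orderable_copy (complete_graph na) \<chi> G)"
    by blast
qed

lemma rainbow_triangle:
  assumes "x < n" "y < n" "z < n" "x \<noteq> y" "y \<noteq> z" "x \<noteq> z"
    and "\<chi> {x, y} \<noteq> \<chi> {y, z}" "\<chi> {x, y} \<noteq> \<chi> {x, z}" "\<chi> {y, z} \<noteq> \<chi> {x, z}"
  shows "has_rainbow_copy (complete_graph n) \<chi> (complete_graph 3)"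
proof -
  define G where "G = Graph {x, y, z} {{x, y}, {x, z}, {y, z}}"
  have "subgraph G (complete_graph n)"
    unfolding subgraph_def complete_graph_def G_def using assms by auto
  moreover have "rainbow G \<chi>"
    unfolding rainbow_def G_def inj_on_def using assms by auto
  moreover have "isomorphic (complete_graph 3) G"
  proof -
    define f where "f i = (if i = 0 then x else if i = 1 then y else z)" for i :: nat
    have v: "{..<3::nat} = {0, 1, 2}" by auto
    have "{{i, j} | i j. i < 3 \<and> j < 3 \<and> i \<noteq> j} = {{0, 1}, {0, 2}, {1, 2 :: nat}}"
    proof (intro equalityI subsetI)
      fix e :: "nat set" assume "e \<in> {{i, j} | i j. i < 3 \<and> j < 3 \<and> i \<noteq> j}"
      then obtain i j where e: "e = {i, j}" "i \<in> {0, 1, 2}" "j \<in> {0, 1, 2}" "i \<noteq> j"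
        unfolding v[symmetric] by auto
      then show "e \<in> {{0, 1}, {0, 2}, {1, 2}}" by (elim insertE emptyE) (simp_all add: insert_commute)
    next
      fix e :: "nat set" assume "e \<in> {{0, 1}, {0, 2}, {1, 2}}"
      then obtain i j where "e = {i, j}" "i < 3" "j < 3" "i \<noteq> j"
        by (elim insertE emptyE) (meson that | simp)+
      then show "e \<in> {{i, j} | i j. i < 3 \<and> j < 3 \<and> i \<noteq> j}" by blast
    qed
    moreover have "bij_betw f {0, 1, 2} {x, y, z}"
      unfolding bij_betw_def f_def inj_on_def using assms by auto
    ultimately show ?thesis unfolding isomorphic_def G_def complete_graph_def v
      by (intro exI[of _ f]) (simp add: f_def insert_commute)
  qed
  ultimately show ?thesis unfolding has_rainbow_copy_def by blast
qed

subsection \<open>Averaging over tuples in two-colored graphs\<close>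

text \<open>The falling factorial. Truncated subtraction is harmless, since the product then already
  contains the factor 0.\<close>

fun ffact :: "nat \<Rightarrow> nat \<Rightarrow> real" where
  "ffact n 0 = 1"
| "ffact n (Suc k) = real n * ffact (n - 1) k"

lemma ffact_nonneg: "0 \<le> ffact n k"
  by (induction k arbitrary: n) auto

lemma ffact_pos: "k \<le> n \<Longrightarrow> 0 < ffact n k"
  by (induction k arbitrary: n) auto

text \<open>If \<open>n < k\<close>, the real factor is negative but \<open>ffact n k\<close>
  vanishes.\<close>

lemma ffact_Suc_right: "ffact n (Suc k) = ffact n k * (real n - real k)"
proof (induction k arbitrary: n)
  case (Suc k)
  show ?case
  proof (cases n)
    case (Suc m)
    have "ffact n (Suc (Suc k)) = real n * ffact m (Suc k)" using Suc by simp
    also have "\<dots> = real n * (ffact m k * (real m - real k))" by (simp only: Suc.IH)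
    finally show ?thesis using Suc by simp
  qed simp
qed simp

lemma ffact_mono: "m \<le> n \<Longrightarrow> ffact m k \<le> ffact n k"
proof (induction k arbitrary: m n)
  case (Suc k)
  then show ?case by (auto intro!: mult_mono simp: ffact_nonneg)
qed simp

text \<open>Chebyshev's sum inequality: \<open>ffact\<close> is monotone in its first argument, so
  the differences of the values and of the arguments have the same sign.\<close>

lemma ffact_add_step:
  "(ffact r k + ffact u k) * (real r + real u - 2 * real k) \<le> 2 * (ffact r (Suc k) + ffact u (Suc k))"
proof -
  have "0 \<le> (ffact r k - ffact u k) * (real r - real u)"
    using ffact_mono[of r u k] ffact_mono[of u r k]
    by (cases "r \<le> u") (auto simp: mult_nonpos_nonpos)
  then show ?thesis unfolding ffact_Suc_right by (simp add: algebra_simps)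
qed

text \<open>With color classes of sizes \<open>r\<close> and \<open>u\<close>, this bounds the
  number of one-colored tuples of length \<open>k + 1\<close>. The inductive step multiplies by
  \<open>N - 2 * (k + 1)\<close> through \<open>ffact_add_step\<close>; where this factor is
  negative, the right-hand side is at most 0.\<close>

lemma ffact_add_ge:
  "2 ^ k * (ffact r (Suc k) + ffact u (Suc k)) \<ge>
     ffact (r + u) k * (real (r + u) + 1 - (real k + 1) * (real k + 2) / 2) \<and>
   (2 \<le> k \<longrightarrow> k < r + u \<longrightarrow> 2 ^ k * (ffact r (Suc k) + ffact u (Suc k)) >
     ffact (r + u) k * (real (r + u) + 1 - (real k + 1) * (real k + 2) / 2))"
proof (induction k)
  case (Suc k)
  define N where "N = real (r + u)"
  define h where "h = 2 ^ k * (ffact r (Suc k) + ffact u (Suc k))"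
  define h' where "h' = 2 ^ Suc k * (ffact r (Suc (Suc k)) + ffact u (Suc (Suc k)))"
  define F where "F = ffact (r + u) k"
  define K where "K = N + 1 - (real k + 1) * (real k + 2) / 2"
  have F0: "0 \<le> F" unfolding F_def by (rule ffact_nonneg)
  have F1: "ffact (r + u) (Suc k) = F * (N - real k)" unfolding F_def N_def by (rule ffact_Suc_right)
  have h'0: "0 \<le> h'" unfolding h'_def by (intro mult_nonneg_nonneg add_nonneg_nonneg ffact_nonneg) auto
  let ?R = "F * (N - real k) * (N + 1 - (real k + 2) * (real k + 3) / 2)"
  have "h' \<ge> ?R \<and> (1 \<le> k \<longrightarrow> Suc k < r + u \<longrightarrow> h' > ?R)"
  proof (cases "2 * (k + 1) \<le> r + u")
    case True
    then have N: "0 \<le> N - 2 * (real k + 1)" unfolding N_def by (simp add: of_nat_add[symmetric] del: of_nat_add)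
    have "F * K * (N - 2 * (real k + 1)) \<le> h * (N - 2 * (real k + 1))"
      using Suc.IH N unfolding h_def F_def K_def N_def by (intro mult_right_mono) auto
    also have "\<dots> \<le> h'"
    proof -
      have "2 ^ k * ((ffact r (Suc k) + ffact u (Suc k)) * (real r + real u - 2 * real (Suc k)))
        \<le> 2 ^ k * (2 * (ffact r (Suc (Suc k)) + ffact u (Suc (Suc k))))"
        by (intro mult_left_mono ffact_add_step) simp
      then show ?thesis unfolding h_def h'_def N_def
        by (simp add: mult.assoc add.commute)
    qed
    finally have 1: "F * K * (N - 2 * (real k + 1)) \<le> h'" .
    \<comment> \<open>The slack on the right is positive from \<open>k = 1\<close> on, which makes
      the inequality for \<open>Suc k\<close> strict.\<close>
    have eq: "F * K * (N - 2 * (real k + 1)) = ?R + F * ((real k + 2) * (real k + 1) * real k / 2)"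
      unfolding K_def by (simp add: field_simps)
    have "0 \<le> F * ((real k + 2) * (real k + 1) * real k / 2)" using F0 by simp
    moreover have "0 < F * ((real k + 2) * (real k + 1) * real k / 2)" if "1 \<le> k"
      using True that ffact_pos[of k "r + u"] unfolding F_def by simp
    ultimately show ?thesis using 1 eq by linarith
  next
    case False
    then have "r + u \<le> 2 * k + 1" by simp
    then have "N \<le> real (2 * k + 1)" unfolding N_def by (rule of_nat_mono)
    then have N: "N \<le> 2 * real k + 1" by simp
    have neg: "N + 1 - (real k + 2) * (real k + 3) / 2 < 0"
    proof -
      have "0 < (real k)\<^sup>2 + real k + 2" by (simp add: add_nonneg_pos)
      then show ?thesis using N by (simp add: field_simps power2_eq_square)
    qed
    have FN: "0 \<le> F * (N - real k)" using F1 ffact_nonneg by metis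
    have "?R \<le> 0" using FN neg by (simp add: mult_nonneg_nonpos)
    moreover have "?R < 0" if "Suc k < r + u"
    proof -
      have "0 < F * (N - real k)" using F1 ffact_pos[of "Suc k" "r + u"] that by simp
      then show ?thesis using neg by (simp add: mult_pos_neg)
    qed
    ultimately show ?thesis using h'0 by linarith
  qed
  moreover have "ffact (r + u) (Suc k) * (real (r + u) + 1 - (real (Suc k) + 1) * (real (Suc k) + 2) / 2) = ?R"
    unfolding F1 N_def by (simp add: add.commute)
  ultimately show ?case unfolding h'_def by (metis One_nat_def Suc_1 Suc_le_mono)
qed simp

text \<open>The expected value, over independent fair choices of one of two colors at each position of the
  list, of the indicator that \<open>b\<close> is compatible with the list and these choices: with probability
  \<open>1/2\<close> the color at \<open>x\<close> is the one seen by \<open>b\<close>, and otherwise \<open>b\<close> has to precede \<open>x\<close>.\<close>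

fun pair_weight :: "('a set \<Rightarrow> 'c) \<Rightarrow> 'a \<Rightarrow> 'a list \<Rightarrow> real" where
  "pair_weight \<chi> b [] = 1"
| "pair_weight \<chi> b (x # xs) =
     (pair_weight \<chi> b xs + of_bool (sees_constant \<chi> b (insert x (set xs)))) / 2"

text \<open>Method of conditional expectations: the color at \<open>x\<close> is set to
  \<open>p\<close> or to \<open>q\<close>. The vertices seeing that color remain for the rest of the
  list, and the others survive only if they can be put in front of \<open>x\<close>. The two
  outcomes add up to at least twice the total weight, so one of them reaches it.\<close>

lemma ordered_pair_weight:
  assumes "finite B" "\<And>b x. b \<in> B \<Longrightarrow> x \<in> set xs \<Longrightarrow> \<chi> {x, b} \<in> {p, q}"
  shows "\<exists>C\<subseteq>B. ordered_pair \<chi> xs C \<and> (\<Sum>b\<in>B. pair_weight \<chi> b xs) \<le> real (card C)"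
  using assms
proof (induction xs arbitrary: B)
  case Nil
  then show ?case by (intro exI[of _ B]) (auto intro: ordered_pair.Nil)
next
  case (Cons x xs)
  define S where "S b \<longleftrightarrow> sees_constant \<chi> b (insert x (set xs))" for b
  define P where "P = {b \<in> B. \<chi> {x, b} = p}"
  define Q where "Q = B - P"
  have PQ: "finite P" "finite Q" "B = P \<union> Q" "P \<inter> Q = {}"
    using Cons.prems unfolding P_def Q_def by auto
  have col: "\<And>b. b \<in> P \<Longrightarrow> \<chi> {x, b} = p" "\<And>b. b \<in> Q \<Longrightarrow> \<chi> {x, b} = q"
    using Cons.prems(2) unfolding P_def Q_def by auto
  have *: "\<exists>C\<subseteq>B. ordered_pair \<chi> (x # xs) C \<and>
      (\<Sum>b\<in>L. pair_weight \<chi> b xs) + (\<Sum>b\<in>B - L. of_bool (S b)) \<le> real (card C)"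
    if L: "L \<subseteq> B" and c: "\<And>b. b \<in> L \<Longrightarrow> \<chi> {x, b} = c" for L c
  proof -
    have fL: "finite L" using L Cons.prems finite_subset by blast
    have "\<exists>C\<subseteq>L. ordered_pair \<chi> xs C \<and> (\<Sum>b\<in>L. pair_weight \<chi> b xs) \<le> real (card C)"
      by (rule Cons.IH[OF fL]) (use Cons.prems L in auto)
    then obtain C where C: "C \<subseteq> L" "ordered_pair \<chi> xs C"
      "(\<Sum>b\<in>L. pair_weight \<chi> b xs) \<le> real (card C)" by blast
    let ?K = "{b \<in> B - L. S b}"
    have "ordered_pair \<chi> (x # xs) (C \<union> ?K)"
      by (rule ordered_pair.Cons[OF C(2), where c = c]) (use C c in \<open>auto simp: S_def\<close>)
    moreover have "card (C \<union> ?K) = card C + card ?K"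
      using C fL finite_subset Cons.prems(1) by (intro card_Un_disjoint) auto
    moreover have "(\<Sum>b\<in>B - L. of_bool (S b)) = real (card ?K)"
      using Cons.prems(1) by (simp add: of_bool_def sum.If_cases Int_def)
    ultimately show ?thesis using C L by (intro exI[of _ "C \<union> ?K"]) auto
  qed
  obtain C where C: "C \<subseteq> B" "ordered_pair \<chi> (x # xs) C"
    "(\<Sum>b\<in>P. pair_weight \<chi> b xs) + (\<Sum>b\<in>B - P. of_bool (S b)) \<le> real (card C)"
    using *[of P p] col PQ by blast
  obtain D where D: "D \<subseteq> B" "ordered_pair \<chi> (x # xs) D"
    "(\<Sum>b\<in>Q. pair_weight \<chi> b xs) + (\<Sum>b\<in>B - Q. of_bool (S b)) \<le> real (card D)"
    using *[of Q q] col PQ by blast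
  have BPQ: "B - P = Q" "B - Q = P" using PQ by auto
  have "2 * (\<Sum>b\<in>B. pair_weight \<chi> b (x # xs)) =
      (\<Sum>b\<in>B. pair_weight \<chi> b xs) + (\<Sum>b\<in>B. of_bool (S b))"
    by (simp add: S_def sum.distrib[symmetric] sum_divide_distrib[symmetric])
  also have "\<dots> \<le> real (card C) + real (card D)"
  proof -
    have "(\<Sum>b\<in>B. g b) = (\<Sum>b\<in>P. g b) + (\<Sum>b\<in>Q. g b)" for g :: "'a \<Rightarrow> real"
      unfolding PQ(3) by (rule sum.union_disjoint[OF PQ(1,2,4)])
    then show ?thesis using C(3) D(3) unfolding BPQ by simp
  qed
  finally have "(\<Sum>b\<in>B. pair_weight \<chi> b (x # xs)) \<le> real (card C) \<or>
    (\<Sum>b\<in>B. pair_weight \<chi> b (x # xs)) \<le> real (card D)" by linarith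
  then show ?case using C D by blast
qed

section \<open>Sums over ordered tuples of distinct vertices\<close>

definition tuples :: "nat \<Rightarrow> 'a set \<Rightarrow> 'a list set" where
  "tuples k U = {xs. length xs = k \<and> distinct xs \<and> set xs \<subseteq> U}"

lemma finite_tuples: "finite U \<Longrightarrow> finite (tuples k U)"
  unfolding tuples_def by (rule finite_subset[OF _ finite_lists_length_eq[of U k]]) auto

lemma tuples_0 [simp]: "tuples 0 U = {[]}"
  by (auto simp: tuples_def)

lemma sum_tuples_Suc:
  assumes "finite U"
  shows "sum f (tuples (Suc k) U) = (\<Sum>x\<in>U. \<Sum>xs\<in>tuples k (U - {x}). f (x # xs))"
proof -
  have "tuples (Suc k) U = (\<lambda>(x, xs). x # xs) ` (SIGMA x:U. tuples k (U - {x}))"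
    unfolding tuples_def by (auto simp: length_Suc_conv image_iff) 
  moreover have "inj_on (\<lambda>(x, xs). x # xs) (SIGMA x:U. tuples k (U - {x}))"
    by (auto simp: inj_on_def)
  ultimately show ?thesis
    using assms by (simp add: sum.reindex sum.Sigma finite_tuples split_def)
qed

lemma card_tuples: "finite U \<Longrightarrow> real (card (tuples k U)) = ffact (card U) k"
proof (induction k arbitrary: U)
  case (Suc k)
  have "real (card (tuples (Suc k) U)) = (\<Sum>xs\<in>tuples (Suc k) U. 1)" by simp
  also have "\<dots> = (\<Sum>x\<in>U. real (card (tuples k (U - {x}))))"
    unfolding sum_tuples_Suc[OF Suc.prems] by simp
  also have "\<dots> = (\<Sum>x\<in>U. ffact (card U - 1) k)"
    by (intro sum.cong) (use Suc in auto)
  finally show ?case by simp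
qed simp

text \<open>The tuples counted lie inside one of the two color classes of \<open>b\<close>. The
  length \<open>Suc k\<close> excludes the empty tuple, which would lie in both.\<close>

lemma sum_constant_tuples:
  assumes U: "finite U" and col: "\<And>x. x \<in> U \<Longrightarrow> \<chi> {x, b} \<in> {p, q}"
  shows "\<exists>r u. r + u = card U \<and>
    (\<Sum>xs\<in>tuples (Suc k) U. of_bool (sees_constant \<chi> b (set xs))) = ffact r (Suc k) + ffact u (Suc k)"
proof -
  define P where "P = {x \<in> U. \<chi> {x, b} = p}"
  define Q where "Q = U - P"
  have PQ: "finite P" "finite Q" "U = P \<union> Q" "P \<inter> Q = {}"
    using U unfolding P_def Q_def by auto
  have colQ: "\<And>x. x \<in> Q \<Longrightarrow> \<chi> {x, b} = q \<and> q \<noteq> p" using col unfolding P_def Q_def by auto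
  have iff: "sees_constant \<chi> b X \<longleftrightarrow> X \<subseteq> P \<or> X \<subseteq> Q" if "X \<subseteq> U" for X
  proof
    assume s: "sees_constant \<chi> b X"
    show "X \<subseteq> P \<or> X \<subseteq> Q"
    proof (rule ccontr)
      assume "\<not> (X \<subseteq> P \<or> X \<subseteq> Q)"
      then obtain x y where xy: "x \<in> X" "x \<notin> P" "y \<in> X" "y \<notin> Q" by blast
      then have "x \<in> Q" "y \<in> P" using that PQ(3) by auto
      then have "\<chi> {x, b} \<noteq> \<chi> {y, b}" using colQ[of x] unfolding P_def by simp
      then show False using s xy unfolding sees_constant_def by blast
    qed
  qed (use colQ in \<open>auto simp: sees_constant_def P_def subset_iff\<close>)
  have "{xs \<in> tuples (Suc k) U. sees_constant \<chi> b (set xs)} = tuples (Suc k) P \<union> tuples (Suc k) Q"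
    using iff PQ(3) unfolding tuples_def by auto
  moreover have "tuples (Suc k) P \<inter> tuples (Suc k) Q = {}"
  proof -
    have False if "xs \<in> tuples (Suc k) P" "xs \<in> tuples (Suc k) Q" for xs
      using that PQ(4) unfolding tuples_def by (cases xs) auto
    then show ?thesis by blast
  qed
  ultimately have "real (card {xs \<in> tuples (Suc k) U. sees_constant \<chi> b (set xs)}) =
      ffact (card P) (Suc k) + ffact (card Q) (Suc k)"
    using PQ by (simp add: card_Un_disjoint finite_tuples card_tuples del: ffact.simps)
  moreover have "(\<Sum>xs\<in>tuples (Suc k) U. of_bool (sees_constant \<chi> b (set xs))) =
      real (card {xs \<in> tuples (Suc k) U. sees_constant \<chi> b (set xs)})"
    using finite_tuples[OF U] by (simp add: of_bool_def sum.If_cases Int_def)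
  moreover have "card P + card Q = card U" using PQ card_Un_disjoint by metis
  ultimately show ?thesis by metis
qed

text \<open>Splitting off the first entry, twice the sum \<open>W\<close> consists of the sums for
  the shorter tuples and the number \<open>H\<close> of one-colored tuples. The induction hypothesis
  bounds the former by \<open>T\<close>, \<open>ffact_add_ge\<close> bounds \<open>H\<close> by
  \<open>J\<close>, and \<open>T + J\<close> is exactly twice the claimed bound \<open>Z\<close>.
  Strictness comes from \<open>H\<close> alone.\<close>

lemma sum_pair_weight_ge:
  assumes "finite U" "\<And>x. x \<in> U \<Longrightarrow> \<chi> {x, b} \<in> {p, q}"
  shows "(real k + 2) / 2 ^ Suc k * (real (card U) + 1 - (real k + 1) * (real k + 6) / 6) * ffact (card U) k
      \<le> (\<Sum>xs\<in>tuples (Suc k) U. pair_weight \<chi> b xs) \<and>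
    (2 \<le> k \<longrightarrow> k < card U \<longrightarrow>
      (real k + 2) / 2 ^ Suc k * (real (card U) + 1 - (real k + 1) * (real k + 6) / 6) * ffact (card U) k
      < (\<Sum>xs\<in>tuples (Suc k) U. pair_weight \<chi> b xs))"
  using assms
proof (induction k arbitrary: U)
  case 0
  have "(\<Sum>xs\<in>tuples (Suc 0) U. pair_weight \<chi> b xs) = real (card U)"
    unfolding sum_tuples_Suc[OF 0(1)] by (simp add: sees_constant_def)
  then show ?case by simp
next
  case (Suc k)
  define N where "N = real (card U)"
  define F where "F = ffact (card U) (Suc k)"
  define W where "W = (\<Sum>xs\<in>tuples (Suc (Suc k)) U. pair_weight \<chi> b xs)"
  define H where "H = (\<Sum>xs\<in>tuples (Suc (Suc k)) U. of_bool (sees_constant \<chi> b (set xs)) :: real)"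
  define T where "T = (real k + 2) / 2 ^ Suc k * (N - (real k + 1) * (real k + 6) / 6) * F"
  have W: "2 * W = (\<Sum>x\<in>U. \<Sum>xs\<in>tuples (Suc k) (U - {x}). pair_weight \<chi> b xs) + H"
    unfolding W_def H_def sum_tuples_Suc[OF Suc.prems(1)]
    by (simp add: sum.distrib[symmetric] sum_divide_distrib[symmetric])
  have "(\<Sum>x\<in>U. \<Sum>xs\<in>tuples (Suc k) (U - {x}). pair_weight \<chi> b xs) \<ge> (\<Sum>x\<in>U. (real k + 2) / 2 ^ Suc k *
      (N - (real k + 1) * (real k + 6) / 6) * ffact (card U - 1) k)"
  proof (rule sum_mono)
    fix x assume x: "x \<in> U"
    then have "card (U - {x}) = card U - 1" "real (card U - 1) + 1 = N"
      using Suc.prems(1) card_gt_0_iff[of U] unfolding N_def by auto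
    then show "(real k + 2) / 2 ^ Suc k * (N - (real k + 1) * (real k + 6) / 6) * ffact (card U - 1) k
      \<le> (\<Sum>xs\<in>tuples (Suc k) (U - {x}). pair_weight \<chi> b xs)"
      using conjunct1[OF Suc.IH[of "U - {x}"]] Suc.prems by simp
  qed
  also have "(\<Sum>x\<in>U. (real k + 2) / 2 ^ Suc k *
      (N - (real k + 1) * (real k + 6) / 6) * ffact (card U - 1) k) = T"
    unfolding T_def F_def N_def by (simp add: mult.assoc mult.left_commute)
  finally have T: "T + H \<le> 2 * W" using W by linarith
  obtain r u where ru: "r + u = card U" "H = ffact r (Suc (Suc k)) + ffact u (Suc (Suc k))"
    using sum_constant_tuples[where \<chi> = \<chi> and b = b and p = p and q = q, OF Suc.prems] unfolding H_def by blast
  define J where "J = F * (N + 1 - (real k + 2) * (real k + 3) / 2) / 2 ^ Suc k"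
  have J: "J \<le> H" "1 \<le> k \<Longrightarrow> Suc k < card U \<Longrightarrow> J < H"
  proof -
    have eq: "real (Suc k) + 1 = real k + 2" "real (Suc k) + 2 = real k + 3"
      "2 \<le> Suc k \<longleftrightarrow> 1 \<le> k" by auto
    note ge = ffact_add_ge[where k = "Suc k" and r = r and u = u, unfolded ru(1) ru(2)[symmetric] eq]
    have p: "(0::real) < 2 ^ Suc k" by simp
    show "J \<le> H" unfolding J_def F_def N_def pos_divide_le_eq[OF p]
      using ge by (simp only: mult.commute[of H])
    show "J < H" if "1 \<le> k" "Suc k < card U" unfolding J_def F_def N_def pos_divide_less_eq[OF p]
      using ge that by (simp only: mult.commute[of H])
  qed
  define Z where "Z = (real (Suc k) + 2) / 2 ^ Suc (Suc k) *
      (N + 1 - (real (Suc k) + 1) * (real (Suc k) + 6) / 6) * F"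
  have "T + J = 2 * Z"
  proof -
    have "T + J = ((real k + 2) * (N - (real k + 1) * (real k + 6) / 6) +
      (N + 1 - (real k + 2) * (real k + 3) / 2)) * F / 2 ^ Suc k"
      unfolding T_def J_def by (simp add: field_simps)
    also have "(real k + 2) * (N - (real k + 1) * (real k + 6) / 6) +
      (N + 1 - (real k + 2) * (real k + 3) / 2) =
      (real (Suc k) + 2) * (N + 1 - (real (Suc k) + 1) * (real (Suc k) + 6) / 6)"
      by (simp add: field_simps)
    finally show ?thesis unfolding Z_def by simp
  qed
  then have "Z \<le> W \<and> (2 \<le> Suc k \<longrightarrow> Suc k < card U \<longrightarrow> Z < W)" using T J by auto
  then show ?case unfolding Z_def W_def N_def F_def .
qed

text \<open>The argument \<open>n\<close> is real because the induction also evaluates the bound at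
  half of a vertex count.\<close>

definition bound :: "nat \<Rightarrow> real \<Rightarrow> real" where
  "bound s n = (real s + 1) / 2 ^ s * (n - real s * (real s + 5) / 6)"

text \<open>Double counting of pairs of a tuple and a vertex \<open>b\<close> outside it: some tuple
  attains at least the average total weight, and \<open>ordered_pair_weight\<close> turns this
  weight into a set \<open>B\<close>.\<close>

lemma two_colored_ordered_pair:
  assumes fin: "finite V" and s: "1 \<le> s" "s < card V"
    and col: "\<And>x y. x \<in> V \<Longrightarrow> y \<in> V \<Longrightarrow> x \<noteq> y \<Longrightarrow> \<chi> {x, y} \<in> {p, q}"
  shows "\<exists>xs B. distinct xs \<and> length xs = s \<and> set xs \<subseteq> V \<and> B \<subseteq> V - set xs \<and> ordered_pair \<chi> xs B \<and>
    bound s (card V) \<le> card B \<and> (3 \<le> s \<longrightarrow> bound s (card V) < card B)"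
proof -
  obtain k where k: "s = Suc k" using s by (cases s) auto
  let ?n = "card V"
  let ?t = "\<lambda>xs. \<Sum>b\<in>V - set xs. pair_weight \<chi> b xs"
  have n: "?n \<ge> 1" using s by linarith
  have "(\<Sum>xs\<in>tuples s V. ?t xs) =
      (\<Sum>xs\<in>tuples s V. \<Sum>b\<in>{b \<in> V. b \<notin> set xs}. pair_weight \<chi> b xs)"
    by (intro sum.cong) auto
  also have "\<dots> = (\<Sum>b\<in>V. \<Sum>xs\<in>{xs \<in> tuples s V. b \<notin> set xs}. pair_weight \<chi> b xs)"
    by (rule sum.swap_restrict) (use fin finite_tuples in auto)
  also have "\<dots> = (\<Sum>b\<in>V. \<Sum>xs\<in>tuples s (V - {b}). pair_weight \<chi> b xs)"
    by (intro sum.cong) (auto simp: tuples_def)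
  finally have swap: "(\<Sum>xs\<in>tuples s V. ?t xs) = (\<Sum>b\<in>V. \<Sum>xs\<in>tuples s (V - {b}). pair_weight \<chi> b xs)" .
  define T where "T = (real k + 2) / 2 ^ Suc k * (real ?n - (real k + 1) * (real k + 6) / 6) * ffact (?n - 1) k"
  have b: "T \<le> (\<Sum>xs\<in>tuples s (V - {b}). pair_weight \<chi> b xs) \<and>
    (3 \<le> s \<longrightarrow> T < (\<Sum>xs\<in>tuples s (V - {b}). pair_weight \<chi> b xs))" if "b \<in> V" for b
  proof -
    have c: "card (V - {b}) = ?n - 1" "real (?n - 1) + 1 = ?n" using that fin n by auto
    have "\<chi> {x, b} \<in> {p, q}" if "x \<in> V - {b}" for x using col that \<open>b \<in> V\<close> by blast
    from sum_pair_weight_ge[where U = "V - {b}" and k = k and \<chi> = \<chi> and b = b and p = p and q = q, OF _ this] show ?thesis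
      using c fin s k unfolding T_def by auto
  qed
  \<comment> \<open>Summing over the choices of \<open>b\<close> completes
    \<open>ffact (?n - 1) k\<close> to \<open>ffact ?n s\<close>, the number of tuples, so
    \<open>bound s ?n\<close> is the average per tuple.\<close>
  have tot: "(\<Sum>b\<in>V. T) = (\<Sum>xs\<in>tuples s V. bound s ?n)"
    unfolding T_def bound_def k by (simp add: card_tuples[OF fin] algebra_simps)
  have fint: "finite (tuples s V)" using fin by (rule finite_tuples)
  have "\<exists>xs\<in>tuples s V. bound s ?n \<le> ?t xs \<and> (3 \<le> s \<longrightarrow> bound s ?n < ?t xs)"
  proof (cases "3 \<le> s")
    case True
    have "(\<Sum>xs\<in>tuples s V. bound s ?n) < (\<Sum>xs\<in>tuples s V. ?t xs)"
      unfolding swap tot[symmetric] using b True n fin by (intro sum_strict_mono) auto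
    then have "\<not> (\<forall>xs\<in>tuples s V. ?t xs \<le> bound s ?n)"
      using sum_mono[of "tuples s V" ?t "\<lambda>_. bound s ?n"] by (meson not_less)
    then show ?thesis by force
  next
    case False
    have "(\<Sum>xs\<in>tuples s V. bound s ?n) \<le> (\<Sum>xs\<in>tuples s V. ?t xs)"
      unfolding swap tot[symmetric] using b by (intro sum_mono) auto
    moreover have "tuples s V \<noteq> {}"
      using card_tuples[OF fin, of s] ffact_pos[of s ?n] s by auto
    ultimately have "\<not> (\<forall>xs\<in>tuples s V. ?t xs < bound s ?n)"
      using sum_strict_mono[OF fint, of ?t "\<lambda>_. bound s ?n"] by (meson not_less)
    then show ?thesis using False by force
  qed
  then obtain xs where xs: "xs \<in> tuples s V" "bound s ?n \<le> ?t xs" "3 \<le> s \<longrightarrow> bound s ?n < ?t xs"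
    by blast
  have "\<exists>B\<subseteq>V - set xs. ordered_pair \<chi> xs B \<and> ?t xs \<le> real (card B)"
    by (rule ordered_pair_weight[where p = p and q = q]) (use fin col xs(1) in \<open>auto simp: tuples_def\<close>)
  then obtain B where "B \<subseteq> V - set xs" "ordered_pair \<chi> xs B" "?t xs \<le> real (card B)" by blast
  then show ?thesis
    by (intro exI[of _ xs] exI[of _ B]) (use xs in \<open>auto simp: tuples_def\<close>)
qed

subsection \<open>The upper bound for colorings without rainbow triangle\<close>

lemma cube_less_pow2: "6 \<le> s \<Longrightarrow> (real s + 1) * (real s * (real s - 1) - 3) < 3 * 2 ^ s"
proof (induction s rule: dec_induct)
  case (step n)
  \<comment> \<open>The shift makes all coefficients nonnegative when the left-hand side is compared
    with twice its previous value. The start at 6 is tight: 189 < 192.\<close>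
  define x where "x = real n - 6"
  have x: "real n = x + 6" "0 \<le> x" using step unfolding x_def by auto
  have "(real (Suc n) + 1) * (real (Suc n) * (real (Suc n) - 1) - 3)
      \<le> 2 * ((real n + 1) * (real n * (real n - 1) - 3))"
    using x(2) by (simp add: x(1) algebra_simps)
  also have "\<dots> < 3 * 2 ^ Suc n" using step by simp
  finally show ?case .
qed simp

text \<open>In this range a single vertex suffices as the large side. The excluded pair is a genuine
  exception, as \<open>bound 5 14\<close> is 17/16.\<close>

lemma bound_less_1:
  assumes s: "4 \<le> s" and n: "2 * n < s * (s + 1)" and ex: "\<not> (s = 5 \<and> n = 14)"
  shows "bound s (real n) < 1"
proof -
  have n': "real n \<le> real s * (real s + 1) / 2 - 1"
  proof -
    \<comment> \<open>By parity the strict inequality gains 2 instead of 1.\<close>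
    have "even (s * (s + 1))" by simp
    then have "2 * n + 2 \<le> s * (s + 1)" using n by presburger
    then have "real (2 * n + 2) \<le> real (s * (s + 1))" by (rule of_nat_mono)
    then show ?thesis by (simp add: algebra_simps)
  qed
  consider "s = 4" | "s = 5" | "6 \<le> s" using s by linarith
  then show ?thesis
  proof cases
    case 1
    then show ?thesis using n' by (simp add: bound_def)
  next
    case 2
    then have "n \<le> 13" using n ex by simp
    then show ?thesis using 2 by (simp add: bound_def)
  next
    case 3
    have "bound s (real n) \<le> (real s + 1) / 2 ^ s * (real s * (real s + 1) / 2 - 1 - real s * (real s + 5) / 6)"
      unfolding bound_def using n' by (intro mult_left_mono) auto
    also have "\<dots> = (real s + 1) * (real s * (real s - 1) - 3) / (3 * 2 ^ s)"
      by (simp add: field_simps)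
    also have "\<dots> < 1" using cube_less_pow2[OF 3] by (simp add: divide_less_eq)
    finally show ?thesis .
  qed
qed

text \<open>The slope \<open>(s + 1) / 2 ^ s\<close> is at most 1, so a vertex that can be added to
  \<open>B\<close> always pays for itself.\<close>

lemma bound_diff_le:
  assumes "m \<le> n" "1 \<le> s" shows "bound s n - bound s m \<le> n - m"
proof -
  have "(real s + 1) / 2 ^ s \<le> 1"
  proof -
    have "s + 1 \<le> 2 ^ s" by (induction s) auto
    then have "real (s + 1) \<le> real (2 ^ s)" by (rule of_nat_mono)
    then show ?thesis by (simp add: divide_le_eq)
  qed
  then have "(real s + 1) / 2 ^ s * (n - m) \<le> 1 * (n - m)"
    using assms by (intro mult_right_mono) auto
  moreover have "bound s n - bound s m = (real s + 1) / 2 ^ s * (n - m)"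
    unfolding bound_def right_diff_distrib by simp
  ultimately show ?thesis by simp
qed

lemma bound_mono: "x \<le> y \<Longrightarrow> bound s x \<le> bound s y"
  unfolding bound_def by (intro mult_left_mono) auto

text \<open>Equality holds at \<open>m = 2\<close> with \<open>n\<close> on the threshold; the substitution \<open>k = p + 2\<close>, \<open>m = q + 2\<close>
  turns the difference of both sides into a polynomial with nonnegative coefficients.\<close>

lemma bound_half_ge:
  assumes k: "2 \<le> k" and m: "2 \<le> m" and n: "real (k + m) * (real (k + m) + 1) / 2 \<le> n"
  shows "bound (k + m) n \<le> bound k ((n - real m) / 2) \<and>
    (3 \<le> m \<longrightarrow> bound (k + m) n < bound k ((n - real m) / 2))"
proof -
  define p where "p = real k - 2"
  define q where "q = real m - 2"
  define z where "z = n - real (k + m) * (real (k + m) + 1) / 2"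
  have kp: "real k = p + 2" "0 \<le> p" using k unfolding p_def by auto
  have mq: "real m = q + 2" "0 \<le> q" using m unfolding q_def by auto
  have z: "n = z + real (k + m) * (real (k + m) + 1) / 2" "0 \<le> z" using n unfolding z_def by auto
  have pow: "real m \<le> 2 ^ (m - 1)"
  proof -
    have "m \<le> 2 ^ (m - 1)" using m
    proof (induction m rule: dec_induct)
      case (step i)
      have "2 ^ (Suc i - 1) = 2 * (2::nat) ^ (i - 1)" using step by (cases i) auto
      then show ?case using step by linarith
    qed simp
    then have "real m \<le> real (2 ^ (m - 1))" by (rule of_nat_mono)
    then show ?thesis by simp
  qed
  \<comment> \<open>After multiplication by \<open>2 ^ (k + m)\<close> the two bounds become
    \<open>L\<close> and \<open>2 ^ (m - 1) * (k + 1) * D\<close>. Replacing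
    \<open>2 ^ (m - 1)\<close> by the smaller \<open>m\<close> makes the comparison
    polynomial.\<close>
  define D where "D = n - real m - real k * (real k + 5) / 3"
  define L where "L = (real k + real m + 1) * (n - real (k + m) * (real (k + m) + 5) / 6)"
  have D: "D = z + ((p + 2)\<^sup>2 + 6 * (p + 2) * (q + 2) + 3 * (q + 2)\<^sup>2 - 3 * (q + 2) - 7 * (p + 2)) / 6"
    unfolding D_def z(1) of_nat_add kp(1) mq(1) by (simp add: field_simps power2_eq_square)
  have D0: "0 \<le> D"
  proof -
    have "(p + 2)\<^sup>2 + 6 * (p + 2) * (q + 2) + 3 * (q + 2)\<^sup>2 - 3 * (q + 2) - 7 * (p + 2) =
      p\<^sup>2 + 6 * (p * q) + 3 * q\<^sup>2 + 9 * p + 21 * q + 20"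
      by (simp add: field_simps power2_eq_square)
    moreover have "0 \<le> p * q" using kp mq by simp
    ultimately show ?thesis unfolding D using kp(2) mq(2) z(2) by (simp only:) simp
  qed
  have L: "L = (p + q + 5) * (z + (p + q + 4) * (p + q + 3) / 3)"
    unfolding L_def z(1) of_nat_add kp(1) mq(1) by (simp add: field_simps)
  have "real m * (real k + 1) * D - L = (p * q + 2 * q + p + 1) * z +
      (p ^ 3 * q + 6 * (p\<^sup>2 * q\<^sup>2) + 18 * (p\<^sup>2 * q) + 3 * (p * q ^ 3) + 39 * (p * q\<^sup>2) + 77 * (p * q)
        + 7 * q ^ 3 + 57 * q\<^sup>2 + 92 * q) / 6"
    unfolding L D kp(1) mq(1) by (simp add: field_simps power2_eq_square power3_eq_cube)
  moreover have "0 \<le> (p * q + 2 * q + p + 1) * z" using kp mq z by simp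
  moreover have "0 \<le> p ^ 3 * q + 6 * (p\<^sup>2 * q\<^sup>2) + 18 * (p\<^sup>2 * q) + 3 * (p * q ^ 3) + 39 * (p * q\<^sup>2)
      + 77 * (p * q) + 7 * q ^ 3 + 57 * q\<^sup>2" using kp mq by simp
  \<comment> \<open>Of the term \<open>92 * q / 6\<close> a summand \<open>q = m - 2\<close> is
    kept, which is positive for \<open>3 <= m\<close> and gives strictness.\<close>
  ultimately have LD: "L + q \<le> real m * (real k + 1) * D" using mq by argo
  have "real m * (real k + 1) * D \<le> 2 ^ (m - 1) * (real k + 1) * D"
    using pow D0 by (intro mult_right_mono) auto
  then have *: "L + q \<le> 2 ^ (m - 1) * (real k + 1) * D" using LD by linarith
  have "bound (k + m) n = L / 2 ^ (k + m)" unfolding bound_def L_def by simp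
  moreover have "bound k ((n - real m) / 2) = 2 ^ (m - 1) * (real k + 1) * D / 2 ^ (k + m)"
  proof -
    obtain j where j: "m = Suc j" using m by (cases m) auto
    show ?thesis unfolding bound_def D_def j by (simp add: power_add field_simps)
  qed
  moreover have "L / 2 ^ (k + m) + q / 2 ^ (k + m) \<le> 2 ^ (m - 1) * (real k + 1) * D / 2 ^ (k + m)"
    using * by (simp add: divide_right_mono add_divide_distrib[symmetric])
  moreover have "0 \<le> q / 2 ^ (k + m)" "3 \<le> m \<Longrightarrow> 0 < q / 2 ^ (k + m)"
    using mq by (auto simp: q_def)
  ultimately show ?thesis by linarith
qed

text \<open>For a homogeneous set of size \<open>s - 1\<close> the right-hand side is half of the
  number of remaining vertices. The proof compares slopes, \<open>(s + 1) / 2 ^ s\<close> being at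
  most 1/2, and zeros.\<close>

lemma bound_less_half:
  assumes "3 \<le> s" "real s \<le> n"
  shows "bound s n < (n - real s + 1) / 2"
proof -
  define z where "z = real s * (real s + 5) / 6"
  have z: "real s - 1 < z"
  proof -
    have "0 < real s * (real s - 1) + 6" using assms by (intro add_nonneg_pos mult_nonneg_nonneg) auto
    then show ?thesis unfolding z_def by (simp add: algebra_simps)
  qed
  have k: "(real s + 1) / 2 ^ s \<le> 1 / 2"
  proof -
    have "2 * (s + 1) \<le> 2 ^ s" using assms(1) by (induction s rule: dec_induct) auto
    then have "real (2 * (s + 1)) \<le> real (2 ^ s)" by (rule of_nat_mono)
    then show ?thesis by (simp add: divide_le_eq)
  qed
  show ?thesis
  proof (cases "n \<le> z")
    case True
    then have "(real s + 1) / 2 ^ s * (n - z) \<le> 0" by (intro mult_nonneg_nonpos) auto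
    then have "bound s n \<le> 0" unfolding bound_def z_def .
    also have "0 < (n - real s + 1) / 2" using assms(2) by simp
    finally show ?thesis .
  next
    case False
    then have "(real s + 1) / 2 ^ s * (n - z) \<le> 1 / 2 * (n - z)" using k by (intro mult_right_mono) auto
    then have "bound s n \<le> 1 / 2 * (n - z)" unfolding bound_def z_def .
    also have "\<dots> < (n - real s + 1) / 2" using z by simp
    finally show ?thesis .
  qed
qed

text \<open>When the list uses up all vertices, the empty set has to suffice as the large
  side.\<close>

lemma bound_self:
  assumes "1 \<le> s"
  shows "bound s (real s) \<le> 0" "3 \<le> s \<Longrightarrow> bound s (real s) < 0"
proof -
  have "bound s (real s) = - ((real s + 1) / 2 ^ s * (real s * (real s - 1)) / 6)"
    unfolding bound_def by (simp add: field_simps)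
  then show "bound s (real s) \<le> 0" "3 \<le> s \<Longrightarrow> bound s (real s) < 0"
    using assms by auto
qed

section \<open>The induction on the number of vertices\<close>

definition good_pair :: "('a set \<Rightarrow> 'c) \<Rightarrow> 'a set \<Rightarrow> nat \<Rightarrow> 'a list \<Rightarrow> 'a set \<Rightarrow> bool" where
  "good_pair \<chi> V s xs B \<longleftrightarrow> distinct xs \<and> length xs = s \<and> set xs \<subseteq> V \<and> B \<subseteq> V - set xs \<and> ordered_pair \<chi> xs B"

text \<open>By homogeneity one vertex \<open>x0\<close> of \<open>M\<close> determines the color
  that each outside vertex receives; \<open>R\<close> is the larger of its two color
  classes.\<close>

lemma majority_neighbourhood:
  assumes fin: "finite V" and hom: "homogeneous \<chi> V M" and "M \<noteq> {}"
    and col: "\<And>x z. x \<in> M \<Longrightarrow> z \<in> V - M \<Longrightarrow> \<chi> {x, z} \<in> {a, b}"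
  shows "\<exists>R\<subseteq>V - M. \<exists>c. card (V - M) \<le> 2 * card R \<and> (\<forall>x\<in>M. \<forall>z\<in>R. \<chi> {x, z} = c)"
proof -
  obtain x0 where x0: "x0 \<in> M" using \<open>M \<noteq> {}\<close> by blast
  define R where "R c = {z \<in> V - M. \<chi> {x0, z} = c}" for c
  have "V - M = R a \<union> R b" using col[OF x0] unfolding R_def by blast
  then have "card (V - M) \<le> card (R a) + card (R b)" by (metis card_Un_le)
  then obtain c where c: "card (V - M) \<le> 2 * card (R c)"
    by (cases "card (R a) \<le> card (R b)") (use that[of a] that[of b] in linarith)+
  have "\<chi> {x, z} = c" if "x \<in> M" "z \<in> R c" for x z
    using homogeneousD[OF hom that(1) x0, of z] that(2) unfolding R_def by simp
  moreover have "R c \<subseteq> V - M" unfolding R_def by blast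
  ultimately show ?thesis using c by (intro exI[of _ "R c"] exI[of _ c] conjI ballI)
qed

text \<open>The list length \<open>s\<close> varies in the induction, because a homogeneous set
  smaller than \<open>s\<close> leaves the shorter length \<open>s - card M\<close>. The strict
  version is carried along, since \<open>bound_half_ge\<close> alone gives only a weak inequality
  for \<open>card M = 2\<close>.\<close>

lemma good_pair_gallai:
  assumes "finite V" "gallai \<chi> V" "1 \<le> s" "s \<le> card V"
  shows "\<exists>xs B. good_pair \<chi> V s xs B \<and> bound s (card V) \<le> card B \<and> (3 \<le> s \<longrightarrow> bound s (card V) < card B)"
  using assms
proof (induction V arbitrary: s rule: finite_psubset_induct)
  case (psubset V)
  note fin = psubset.hyps and g = psubset.prems(1) and s = psubset.prems(2,3)
  let ?n = "card V"
  obtain vs where vs: "set vs = V" "distinct vs" using finite_distinct_list[OF fin] by blast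
  then have lvs: "length vs = ?n" using distinct_card by metis
  define us where "us = take s vs"
  have us: "distinct us" "length us = s" "set us \<subseteq> V"
    unfolding us_def using vs lvs s by (auto dest: in_set_takeD)
  consider "s = ?n" | "s < ?n" using s by linarith
  then show ?case
  proof cases
    case 1
    have "ordered_pair \<chi> us {}" by (rule ordered_pair_subset[OF ordered_pair_single_right empty_subsetI])
    then have "good_pair \<chi> V s us {}" using us unfolding good_pair_def by simp
    then show ?thesis using bound_self[OF s(1)] 1 by (intro exI[of _ us] exI[of _ "{}"]) auto
  next
    case sn: 2
    have "2 \<le> ?n" using sn s by linarith
    from fin this g show ?thesis
    proof (cases rule: gallai_structure)
      case (two_colored a b)
      show ?thesis unfolding good_pair_def conj_assoc
        by (rule two_colored_ordered_pair[where p = a and q = b, OF fin s(1) sn]) (rule two_colored)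
    next
      case (homogeneous M a b)
      note hom = homogeneous(1)
      let ?m = "card M"
      have MV: "M \<subseteq> V" "M \<subset> V" "M \<noteq> {}" "finite M"
        using homogeneous(1-3) fin unfolding homogeneous_def by (auto intro: finite_subset)
      have cW: "card (V - M) = ?n - ?m" using MV by (simp add: card_Diff_subset)
      show ?thesis
      proof (cases "s \<le> ?m")
        case True
        obtain xs B where xs: "good_pair \<chi> M s xs B" "bound s ?m \<le> card B" "3 \<le> s \<longrightarrow> bound s ?m < card B"
          using psubset.IH[OF MV(2) gallai_subset[OF g MV(1)] s(1) True] by blast
        \<comment> \<open>Each vertex outside \<open>M\<close> sees all of \<open>xs\<close> in one
          color, so the large side grows by one per vertex, at least as fast as
          \<open>bound s\<close>.\<close>
        have "ordered_pair \<chi> xs (B \<union> (V - M))"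
        proof (rule ordered_pair_add_constant)
          show "ordered_pair \<chi> xs B" using xs unfolding good_pair_def by blast
          fix b assume "b \<in> V - M"
          then show "sees_constant \<chi> b (set xs)"
            using homogeneousD[OF hom] xs(1) unfolding good_pair_def sees_constant_def by blast
        qed
        then have "good_pair \<chi> V s xs (B \<union> (V - M))"
          using xs(1) MV unfolding good_pair_def by auto
        moreover have "card (B \<union> (V - M)) = card B + (?n - ?m)"
        proof -
          have "B \<subseteq> M" using xs(1) unfolding good_pair_def by blast
          then show ?thesis unfolding cW[symmetric] using fin MV
            by (intro card_Un_disjoint) (auto intro: finite_subset)
        qed
        moreover have "bound s ?n - bound s ?m \<le> real (?n - ?m)"
          using bound_diff_le[of "real ?m" "real ?n" s] homogeneous s by (simp add: of_nat_diff)
        ultimately show ?thesis using xs by (intro exI[of _ xs] exI[of _ "B \<union> (V - M)"]) auto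
      next
        case False
        then obtain k where k: "s = k + ?m" "1 \<le> k" 
          by (intro that[of "s - ?m"]) auto
        have s3: "3 \<le> s" using k homogeneous by linarith
        obtain R c where R: "R \<subseteq> V - M" "?n - ?m \<le> 2 * card R" "\<And>x z. x \<in> M \<Longrightarrow> z \<in> R \<Longrightarrow> \<chi> {x, z} = c"
          using majority_neighbourhood[where \<chi> = \<chi> and a = a and b = b, OF fin hom MV(3) homogeneous(4)] unfolding cW by blast
        have halfR: "(real ?n - real ?m) / 2 \<le> real (card R)"
        proof -
          have "?n \<le> 2 * card R + ?m" using R(2) by linarith
          then have "real ?n \<le> real (2 * card R + ?m)" by (rule of_nat_mono)
          then show ?thesis by simp
        qed
        obtain ms where ms: "set ms = M" "distinct ms" using finite_distinct_list[OF MV(4)] by blast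
        then have lms: "length ms = ?m" using distinct_card by metis
        have app: "good_pair \<chi> V s (ms @ ys) B"
          if "ordered_pair \<chi> ys B" "distinct ys" "length ys = k" "set ys \<subseteq> V - M" "B \<subseteq> R - set ys" for ys B
        proof -
          have "ordered_pair \<chi> (ms @ ys) B"
            by (rule ordered_pair_append[OF that(1), where c = c]) (use R(3) ms that(5) in auto)
          then show ?thesis unfolding good_pair_def using that ms lms k R(1) MV(1) by auto
        qed
        have ?thesis if "good_pair \<chi> V s xs B" "bound s ?n < card B" for xs B
          using that by (intro exI[of _ xs] exI[of _ B]) auto
        note finish = this
        \<comment> \<open>The threshold \<open>s * (s + 1) / 2\<close> is the one required by
          \<open>bound_half_ge\<close>; below it a single vertex suffices, except for the pair
          excluded in \<open>bound_less_1\<close>, which joins the last case.\<close>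
        consider "k = 1" | "2 \<le> k" "2 * ?n < s * (s + 1)" "\<not> (s = 5 \<and> ?n = 14)"
          | "2 \<le> k" "s * (s + 1) \<le> 2 * ?n \<or> s = 5 \<and> ?n = 14" using k(2) by linarith
        then show ?thesis
        proof cases
          case 1
          have half: "bound s ?n < (real ?n - real ?m) / 2"
            using bound_less_half[OF s3, of "real ?n"] sn k 1 by simp
          \<comment> \<open>The last list entry \<open>r\<close> is taken outside \<open>R\<close>
            if possible. Otherwise \<open>R\<close> is all of \<open>V - M\<close>, and giving up
            one of its at least two vertices still leaves half of them.\<close>
          show ?thesis
          proof (cases "R = V - M")
            case True
            have cR: "card R = ?n - ?m" using True cW by simp
            then have c2: "2 \<le> card R" using sn k 1 by linarith
            then obtain r where r: "r \<in> R" by fastforce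
            have "good_pair \<chi> V s (ms @ [r]) (R - {r})"
              by (rule app[OF ordered_pair_single_left]) (use r R 1 in auto)
            moreover have "(real ?n - real ?m) / 2 \<le> real (card (R - {r}))"
            proof -
              have "card (R - {r}) = card R - 1" using r by simp
              moreover have "real ?n - real ?m = real (card R)"
                using cR homogeneous(3) by (simp add: of_nat_diff)
              ultimately show ?thesis using c2 by (simp add: of_nat_diff)
            qed
            ultimately show ?thesis using half by (intro finish) auto
          next
            case False
            then obtain r where r: "r \<in> V - M" "r \<notin> R" using R(1) by blast
            have "good_pair \<chi> V s (ms @ [r]) R"
              by (rule app[OF ordered_pair_single_left]) (use r 1 in auto)
            then show ?thesis using half halfR by (intro finish) auto
          qed
        next
          case 2
          have "card (set us) < ?n" using us sn distinct_card by metis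
          then obtain b where b: "b \<in> V" "b \<notin> set us" using us(3) by (metis less_irrefl subsetI subset_antisym)
          have "good_pair \<chi> V s us {b}"
            using us b ordered_pair_single_right unfolding good_pair_def by auto
          moreover have "bound s ?n < real (card {b})"
            using bound_less_1[of s ?n] 2 k homogeneous by simp
          ultimately show ?thesis by (rule finish)
        next
          case 3
          have m2: "2 \<le> ?m" by (rule homogeneous)
          have "k \<le> card R"
            using 3(2)
          proof
            assume "s * (s + 1) \<le> 2 * ?n"
            moreover have "s * 5 \<le> s * (s + 1)" using k 3(1) m2 by (intro mult_le_mono2) simp
            ultimately show ?thesis using R(2) k by linarith
          qed (use R(2) k 3(1) m2 in linarith)
          moreover have "R \<subset> V" using R(1) MV by blast
          ultimately obtain ys B where ys: "good_pair \<chi> R k ys B" "bound k (card R) \<le> card B"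
            "3 \<le> k \<longrightarrow> bound k (card R) < card B"
            using psubset.IH[of R k] gallai_subset[OF g, of R] k(2) by blast
          have "good_pair \<chi> V s (ms @ ys) B"
            by (rule app) (use ys(1) R(1) in \<open>auto simp: good_pair_def\<close>)
          \<comment> \<open>In the two cases \<open>(s, n) = (5, 14)\<close> and \<open>(4, 10)\<close> the estimates fall short, and the
              integrality of \<open>card B\<close> is needed.\<close>
          moreover have "bound s ?n < card B"
          proof (cases "s = 5 \<and> ?n = 14")
            case True
            then have "k = 2 \<or> k = 3" using k 3 m2 by linarith
            moreover have "6 \<le> card R" using R(2) True k 3 m2 by linarith
            then have "bound k 6 \<le> bound k (card R)" by (intro bound_mono) simp
            \<comment> \<open>\<open>bound 2 6\<close> is 11/4, while \<open>bound 3 6\<close> is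
              exactly 1 and is exceeded strictly because \<open>k = 3\<close>.\<close>
            ultimately have "1 < real (card B)" using ys(2,3) by (auto simp: bound_def)
            then have "2 \<le> card B" by linarith
            then show ?thesis using True by (simp add: bound_def)
          next
            case False
            then have n: "s * (s + 1) \<le> 2 * ?n" using 3 by blast
            then have "real (s * (s + 1)) \<le> real (2 * ?n)" by (rule of_nat_mono)
            then have n': "real (k + ?m) * (real (k + ?m) + 1) / 2 \<le> real ?n"
              unfolding k(1) by (simp add: algebra_simps)
            have half: "bound k ((real ?n - real ?m) / 2) \<le> bound k (card R)"
              using halfR by (rule bound_mono)
            show ?thesis
            proof (cases "k = 2 \<and> ?m = 2")
              case True
              then have s4: "s = 4" "k = 2" "?m = 2" using k by auto
              then have "10 \<le> ?n" using n by simp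
              then consider "?n = 10" | "11 \<le> ?n" by linarith
              then show ?thesis
              proof cases
                case 1
                then have "4 \<le> card R" using R(2) s4(3) by linarith
                \<comment> \<open>\<open>bound 2 4\<close> and \<open>bound 4 10\<close> are both
                  5/4, so rounding \<open>card B\<close> up to 2 provides the strictness.\<close>
                then have "bound 2 4 \<le> bound k (card R)" unfolding s4(2) by (intro bound_mono) simp
                also have "\<dots> \<le> card B" by (rule ys(2))
                finally have "1 < real (card B)" by (simp add: bound_def)
                then have "2 \<le> card B" by linarith
                then show ?thesis using 1 s4 by (simp add: bound_def)
              next
                case 2
                have "bound 2 ((real ?n - 2) / 2) \<le> card B" using half ys(2) s4 by simp
                then show ?thesis using 2 s4 by (simp add: bound_def field_simps)
              qed
            next
              case False
              \<comment> \<open>Strictness comes from the induction hypothesis if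
                \<open>3 <= k\<close> and from \<open>bound_half_ge\<close> if
                \<open>3 <= card M\<close>.\<close>
              then have "3 \<le> k \<or> 3 \<le> ?m" using 3(1) m2 by linarith
              then show ?thesis
                using bound_half_ge[OF 3(1) m2 n'] half ys(2,3) k(1) by auto
            qed
          qed
          ultimately show ?thesis by (rule finish)
        qed
      qed
    qed
  qed
qed

text \<open>The premise on \<open>t\<close> says that \<open>t\<close> is at most every size that
  \<open>good_pair_gallai\<close> allows for the large side; this form serves the weak bound for
  \<open>s = 2\<close> and the strict one for \<open>s >= 3\<close> alike.\<close>

lemma CR_triangle_le:
  assumes s: "1 \<le> s" "s \<le> n"
    and t: "\<And>m::nat. bound s n \<le> m \<Longrightarrow> (3 \<le> s \<Longrightarrow> bound s n < m) \<Longrightarrow> t \<le> m"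
  shows "CR (complete_bipartite s t) (complete_graph 3) \<le> enat n"
proof -
  have "has_orderable_copy (complete_graph n) \<chi> (complete_bipartite s t) \<or>
      has_rainbow_copy (complete_graph n) \<chi> (complete_graph 3)" for \<chi> :: "nat set \<Rightarrow> nat"
  proof (cases "gallai \<chi> {..<n}")
    case True
    obtain xs B where xs: "good_pair \<chi> {..<n} s xs B" "bound s n \<le> card B" "3 \<le> s \<longrightarrow> bound s n < card B"
      using good_pair_gallai[OF _ True s(1)] s(2) by auto
    then have "t \<le> card B" using t by blast
    then show ?thesis
      using has_orderable_copy_complete_bipartite[of \<chi> xs B s t n] xs(1) unfolding good_pair_def by blast
  next
    case False
    then show ?thesis using rainbow_triangle[of _ n _ _ \<chi>] unfolding gallai_def by blast
  qed
  then show ?thesis unfolding CR_def by (intro Inf_lower) blast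
qed

theorem theorem1p8:
  shows "(\<forall>t::nat. t \<ge> 2 \<longrightarrow>
            r2' (complete_bipartite 2 t) \<le> CR (complete_bipartite 2 t) (complete_graph 3) \<and>
            CR (complete_bipartite 2 t) (complete_graph 3)
              \<le> enat (nat \<lfloor>4 * real t / 3\<rfloor> + 2)) \<and>
         (\<forall>s t::nat. t \<ge> s \<and> s \<ge> 3 \<longrightarrow>
            r2' (complete_bipartite s t) \<le> CR (complete_bipartite s t) (complete_graph 3) \<and>
            CR (complete_bipartite s t) (complete_graph 3)
              \<le> enat (nat \<lceil>2 ^ s / (real s + 1) * (real t - 1)
                             + (real s - 1) * (real s + 6) / 6\<rceil> + 1))"
proof (intro conjI allI impI r2'_le_CR_triangle)
  fix t :: nat assume "2 \<le> t"
  define n where "n = nat \<lfloor>4 * real t / 3\<rfloor> + 2"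
  have "\<lfloor>4 * real t / 3\<rfloor> = int (4 * t div 3)"
    using floor_divide_of_nat_eq[of "4 * t" 3, where 'a = real] by simp
  then have "n = 4 * t div 3 + 2" unfolding n_def by simp
  \<comment> \<open>This is the integer form of \<open>bound 2 n > t - 1\<close>, which is
    equivalent to \<open>3 * n > 4 * t + 3\<close>.\<close>
  then have "4 * t + 4 \<le> 3 * n" by presburger
  then have "real (4 * t + 4) \<le> real (3 * n)" by (rule of_nat_mono)
  then have "real t - 1 < bound 2 (real n)" by (simp add: bound_def field_simps)
  then show "CR (complete_bipartite 2 t) (complete_graph 3) \<le> enat (nat \<lfloor>4 * real t / 3\<rfloor> + 2)"
    unfolding n_def[symmetric] by (intro CR_triangle_le) (auto simp: n_def)
next
  fix s t :: nat assume st: "t \<ge> s \<and> s \<ge> 3"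
  define X where "X = 2 ^ s / (real s + 1) * (real t - 1) + (real s - 1) * (real s + 6) / 6"
  define n where "n = nat \<lceil>X\<rceil> + 1"
  have X: "X + 1 \<le> real n" unfolding n_def by linarith
  \<comment> \<open>As \<open>(s - 1) * (s + 6) / 6 + 1 = s * (s + 5) / 6\<close>, the value of
    \<open>bound s\<close> at \<open>X + 1\<close> is exactly \<open>t - 1\<close>.\<close>
  have eq: "X + 1 - real s * (real s + 5) / 6 = 2 ^ s / (real s + 1) * (real t - 1)"
    unfolding X_def by (simp add: field_simps)
  moreover have "0 \<le> 2 ^ s / (real s + 1) * (real t - 1)" using st by simp
  moreover have "real s \<le> real s * (real s + 5) / 6" using st by (simp add: field_simps)
  ultimately have sn: "s \<le> n" using X by linarith
  have "real t - 1 = bound s (X + 1)"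
    unfolding bound_def eq by (simp add: add_eq_0_iff)
  also have "\<dots> \<le> bound s n" using X by (rule bound_mono)
  \<comment> \<open>Only \<open>t - 1 <= bound s n\<close> is known, so the strict inequality
    available for \<open>s >= 3\<close> is what yields \<open>t\<close>.\<close>
  finally have "t \<le> m" if "bound s n < real m" for m using that by linarith
  then show "CR (complete_bipartite s t) (complete_graph 3)
      \<le> enat (nat \<lceil>2 ^ s / (real s + 1) * (real t - 1) + (real s - 1) * (real s + 6) / 6\<rceil> + 1)"
    unfolding X_def[symmetric] n_def[symmetric] using st sn by (intro CR_triangle_le) auto
qed

end
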